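(* Let $\epsilon>0$, $I=(0,\epsilon)$ and $\alpha\in\mathbb{R}\setminus\{0\}$. Then the transversal Robin Laplacian $-\Delta_\alpha^I$ has purely discrete spectrum, i.e., its essential spectrum $\sigma_{\mathrm{ess}}(-\Delta_\alpha^I)$ is empty.
   Context: The operator $-\Delta_\alpha^I$ is the self-adjoint operator in $L^2(I)$ acting as $-\Delta_\alpha^I\psi=-\psi''$ with domain $$\mathrm{dom}(-\Delta_\alpha^I)=\{\psi\in H^2(I): -\psi'(0)-\alpha\psi(0)=0,\ \psi'(\epsilon)+\alpha\psi(\epsilon)=0\}.$$ For a self-adjoint operator $T$, the discrete spectrum is the set of isolated eigenvalues of finite multiplicity and $\sigma_{\mathrm{ess}}(T)$ is its complement in $\sigma(T)$. *)

theory Defs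
  imports "HOL-Analysis.Analysis"
begin

section \<open>Square-integrable functions\<close>

text \<open>
  Elements of $L^2(M)$ are handled through representatives: two square-integrable functions
  denote the same vector iff they agree almost everywhere, and every notion below is invariant
  under changing representatives on a null set.
\<close>

definition L2 :: "'a measure \<Rightarrow> ('a \<Rightarrow> complex) set" where
  "L2 M = {f \<in> borel_measurable M. integrable M (\<lambda>x. (cmod (f x))\<^sup>2)}"

definition L2_norm :: "'a measure \<Rightarrow> ('a \<Rightarrow> complex) \<Rightarrow> real" where
  "L2_norm M f = sqrt (\<integral>x. (cmod (f x))\<^sup>2 \<partial>M)"


section \<open>Spectra of unbounded operators\<close>

text \<open>
  An unbounded operator in $L^2(M)$ is given by its graph, a set of pairs of representatives that
  is closed under almost-everywhere equality in both components.
\<close>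

type_synonym 'a L2_operator = "(('a \<Rightarrow> complex) \<times> ('a \<Rightarrow> complex)) set"

definition eigenspace :: "'a measure \<Rightarrow> 'a L2_operator \<Rightarrow> complex \<Rightarrow> ('a \<Rightarrow> complex) set" where
  "eigenspace M T z = {f. \<exists>g. (f, g) \<in> T \<and> (AE x in M. g x = z * f x)}"

definition eigenvalue :: "'a measure \<Rightarrow> 'a L2_operator \<Rightarrow> complex \<Rightarrow> bool" where
  "eigenvalue M T z \<longleftrightarrow> (\<exists>f \<in> eigenspace M T z. \<not> (AE x in M. f x = 0))"

definition finite_multiplicity :: "'a measure \<Rightarrow> 'a L2_operator \<Rightarrow> complex \<Rightarrow> bool" where
  "finite_multiplicity M T z \<longleftrightarrow>
     (\<exists>B. finite B \<and> B \<subseteq> eigenspace M T z \<and>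
        (\<forall>f \<in> eigenspace M T z. \<exists>c. AE x in M. f x = (\<Sum>b\<in>B. c b * b x)))"

text \<open>\<open>T - z\<close> is injective, onto, and has a bounded inverse.\<close>

definition resolvent_set :: "'a measure \<Rightarrow> 'a L2_operator \<Rightarrow> complex set" where
  "resolvent_set M T =
     {z. \<not> eigenvalue M T z \<and>
         (\<forall>h \<in> L2 M. \<exists>(f, g) \<in> T. AE x in M. g x - z * f x = h x) \<and>
         (\<exists>C. \<forall>(f, g) \<in> T. L2_norm M f \<le> C * L2_norm M (\<lambda>x. g x - z * f x))}"

definition spectrum :: "'a measure \<Rightarrow> 'a L2_operator \<Rightarrow> complex set" where
  "spectrum M T = - resolvent_set M T"

definition discrete_spectrum :: "'a measure \<Rightarrow> 'a L2_operator \<Rightarrow> complex set" where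
  "discrete_spectrum M T =
     {z. eigenvalue M T z \<and> z isolated_in spectrum M T \<and> finite_multiplicity M T z}"

definition essential_spectrum :: "'a measure \<Rightarrow> 'a L2_operator \<Rightarrow> complex set" where
  "essential_spectrum M T = spectrum M T - discrete_spectrum M T"


section \<open>Weak derivatives and Sobolev spaces on open subsets of the line\<close>

text \<open>
  Real-valued test functions suffice also for complex-valued \<open>f\<close>: a complex test function
  splits into its real and imaginary parts.
\<close>

definition test_functions :: "real set \<Rightarrow> (real \<Rightarrow> real) set" where
  "test_functions S =
     {\<phi>. (\<forall>k x. (deriv ^^ k) \<phi> field_differentiable (at x)) \<and>
         compact (closure {x. \<phi> x \<noteq> 0}) \<and> closure {x. \<phi> x \<noteq> 0} \<subseteq> S}"

text \<open>
  The integrals below exist, and are not a default value, whenever \<open>f\<close> and \<open>g\<close> are locally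
  integrable on \<open>S\<close>, in particular for square-integrable ones.
\<close>

definition has_weak_derivative ::
    "real set \<Rightarrow> nat \<Rightarrow> (real \<Rightarrow> complex) \<Rightarrow> (real \<Rightarrow> complex) \<Rightarrow> bool" where
  "has_weak_derivative S k f g \<longleftrightarrow>
     (\<forall>\<phi> \<in> test_functions S.
        (\<integral>x. (deriv ^^ k) \<phi> x *\<^sub>R f x \<partial>lebesgue_on S)
          = (- 1) ^ k * (\<integral>x. \<phi> x *\<^sub>R g x \<partial>lebesgue_on S))"

definition sobolev_H :: "nat \<Rightarrow> real set \<Rightarrow> (real \<Rightarrow> complex) set" where
  "sobolev_H k S =
     {f \<in> L2 (lebesgue_on S). \<forall>j\<le>k. \<exists>g \<in> L2 (lebesgue_on S). has_weak_derivative S j f g}"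


section \<open>The transversal Robin Laplacian\<close>

text \<open>
  For \<open>\<psi>\<close> in \<open>H\<^sup>2(0, \<epsilon>)\<close> the boundary values are those of the continuous representatives
  \<open>u\<close> of \<open>\<psi>\<close> and \<open>v\<close> of its weak derivative on the closed interval. These are uniquely
  determined there, since continuous functions that agree almost everywhere on the interval agree
  on its closure.
\<close>

definition robin_domain :: "real \<Rightarrow> real \<Rightarrow> (real \<Rightarrow> complex) set" where
  "robin_domain \<epsilon> \<alpha> =
     {\<psi> \<in> sobolev_H 2 {0<..<\<epsilon>}.
        \<exists>u v. continuous_on {0..\<epsilon>} u \<and> (AE x in lebesgue_on {0<..<\<epsilon>}. \<psi> x = u x) \<and>
              continuous_on {0..\<epsilon>} v \<and> has_weak_derivative {0<..<\<epsilon>} 1 \<psi> v \<and>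
              - v 0 - complex_of_real \<alpha> * u 0 = 0 \<and>
              v \<epsilon> + complex_of_real \<alpha> * u \<epsilon> = 0}"

definition robin_laplacian :: "real \<Rightarrow> real \<Rightarrow> real L2_operator" where
  "robin_laplacian \<epsilon> \<alpha> =
     {(\<psi>, \<eta>). \<psi> \<in> robin_domain \<epsilon> \<alpha> \<and> \<eta> \<in> L2 (lebesgue_on {0<..<\<epsilon>}) \<and>
        has_weak_derivative {0<..<\<epsilon>} 2 \<psi> (\<lambda>x. - \<eta> x)}"

end

theory Submission
  imports Defs
begin

text \<open>
  Let \<open>S\<close> and \<open>C = S'\<close> be the solutions \<open>sin (k x) / k\<close> and \<open>cos (k x)\<close> of \<open>u'' = - z u\<close>, where
  \<open>k\<^sup>2 = z\<close>. By the du Bois-Reymond lemma, weak solutions of \<open>- f'' - z f = h\<close> are given by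
  variation of constants: \<open>f = c C + d S - S * h\<close>, where \<open>*\<close> is convolution on \<open>(0, x)\<close>. The boundary
  condition at \<open>0\<close> forces \<open>d = - \<alpha> c\<close>, and the one at \<open>\<epsilon>\<close> becomes an equation \<open>c F(z) = b(h)\<close> with
  a bounded functional \<open>b\<close> and \<open>F(z) = - (z + \<alpha>\<^sup>2) S(\<epsilon>)\<close>. Hence \<open>z\<close> lies in the resolvent set if
  \<open>F(z) \<noteq> 0\<close>, and is an eigenvalue with one-dimensional eigenspace otherwise. The zeros of \<open>F\<close>
  are among \<open>- \<alpha>\<^sup>2\<close> and \<open>(n \<pi> / \<epsilon>)\<^sup>2\<close>, which do not accumulate.
\<close>

text \<open>The difficulty is regularity: a weak solution is only integrable a priori, whereas its
  boundary values and the uniqueness of solutions of the differential equation concern classical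
  functions. The du Bois-Reymond lemma treats only the equation u'' = 0, so z is removed in two
  stages. Adding S * h makes the equation homogeneous, p'' = - z p; the kernel x of the case z = 0
  then turns it into (p + z (x * p))'' = 0. So p + z (x * p) is affine, p agrees almost everywhere
  with a continuous function, and the integral equation makes that function twice differentiable.

  Of the spectrum, only its inclusion in the zero set of F is established directly. That suffices,
  because every zero is an eigenvalue of finite multiplicity, and isolation passes to
  subsets.\<close>

section \<open>Test functions\<close>

text \<open>
  For polynomials \<open>r\<close> this family is closed under differentiation, and for \<open>r = 1\<close>, \<open>n = 0\<close>
  it tends to the indicator function of the interval \<open>(a, b)\<close> as \<open>\<delta>\<close> tends to \<open>0\<close>.
\<close>

definition bump :: "real \<Rightarrow> real \<Rightarrow> real \<Rightarrow> real poly \<Rightarrow> nat \<Rightarrow> real \<Rightarrow> real" where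
  "bump \<delta> a b r n x =
     (if a < x \<and> x < b
      then poly r x / ((x - a) * (b - x)) ^ n * exp (- \<delta> / ((x - a) * (b - x))) else 0)"

text \<open>Needed at the two points where the branches of a bump meet. The bound forces
  \<open>f c = 0\<close> and leaves a difference quotient of size at most K |x - c|.\<close>

lemma DERIV_zero_of_quadratic_bound:
  fixes f :: "real \<Rightarrow> real"
  assumes "\<And>x. \<bar>f x\<bar> \<le> K * (x - c)\<^sup>2"
  shows "(f has_real_derivative 0) (at c)"
proof -
  have [simp]: "f c = 0" using assms[of c] by simp
  have K: "0 \<le> K" using assms[of "c + 1"] by simp
  have "((\<lambda>x. f x / (x - c)) \<longlongrightarrow> 0) (at c)"
  proof (rule Lim_null_comparison)
    show "\<forall>\<^sub>F x in at c. norm (f x / (x - c)) \<le> K * \<bar>x - c\<bar>"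
    proof (rule always_eventually)
      show "\<forall>x. norm (f x / (x - c)) \<le> K * \<bar>x - c\<bar>"
      proof
        fix x
        show "norm (f x / (x - c)) \<le> K * \<bar>x - c\<bar>"
          using assms[of x] K
          by (cases "x = c") (simp_all add: divide_simps power2_eq_square abs_mult mult.assoc[symmetric])
      qed
    qed
    have "((\<lambda>x. K * \<bar>x - c\<bar>) \<longlongrightarrow> K * \<bar>c - c\<bar>) (at c)"
      by (intro tendsto_intros)
    then show "((\<lambda>x. K * \<bar>x - c\<bar>) \<longlongrightarrow> 0) (at c)" by simp
  qed
  then show ?thesis by (simp add: has_field_derivative_iff)
qed

text \<open>With y = \<delta> / s this is (y / m)^m \<le> (1 + y / m)^m \<le> exp y, inverted. It
  lets the exponential absorb a pole of any order at the ends of the interval.\<close>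

lemma exp_minus_inverse_le:
  fixes s \<delta> :: real
  assumes "0 < s" "0 < \<delta>" "0 < m"
  shows "exp (- \<delta> / s) \<le> (real m / \<delta>) ^ m * s ^ m"
proof -
  have "(\<delta> / s / m) ^ m \<le> (1 + \<delta> / s / m) ^ m"
    using assms by (intro power_mono) auto
  also have "\<dots> \<le> exp (\<delta> / s)"
    using assms by (intro exp_ge_one_plus_x_over_n_power_n) (auto intro: order_trans[of _ 0])
  finally have "inverse (exp (\<delta> / s)) \<le> inverse ((\<delta> / s / m) ^ m)"
    using assms by (intro le_imp_inverse_le) auto
  then show ?thesis
    using assms by (simp add: exp_minus power_divide power_mult_distrib mult.commute)
qed

text \<open>One of the two factors of s = (x - a) (b - x) is |x - c| and the other is at most b - a,
  so an estimate by \<open>s\<^sup>2\<close> is enough. The exponent n + 2 in \<open>L\<close>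
  cancels the pole of order n and leaves exactly two powers of s.\<close>

lemma bump_quadratic_bound:
  assumes "0 < \<delta>" "a < b" "c = a \<or> c = b"
  obtains K where "\<And>x. \<bar>bump \<delta> a b r n x\<bar> \<le> K * (x - c)\<^sup>2"
proof -
  have "compact (poly r ` {a..b})"
    by (intro compact_continuous_image continuous_intros) auto
  then obtain R where R: "\<And>x. x \<in> {a..b} \<Longrightarrow> \<bar>poly r x\<bar> \<le> R" "0 < R"
    using bounded_pos[of "poly r ` {a..b}"] compact_imp_bounded by fastforce
  define L where "L = (real (n + 2) / \<delta>) ^ (n + 2)"
  have "0 \<le> L" using assms by (simp add: L_def)
  show thesis
  proof (rule that[of "R * L * (b - a)\<^sup>2"])
    fix x
    show "\<bar>bump \<delta> a b r n x\<bar> \<le> R * L * (b - a)\<^sup>2 * (x - c)\<^sup>2"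
    proof (cases "a < x \<and> x < b")
      case True
      define s where "s = (x - a) * (b - x)"
      have "0 < s" using True by (simp add: s_def)
      have "s \<le> (b - a) * \<bar>x - c\<bar>"
        using True assms(3) unfolding s_def
        by (metis abs_minus_commute abs_of_pos diff_gt_0_iff_gt less_eq_real_def diff_mono mult.commute
              mult_left_mono mult_right_mono order_refl)
      then have s2: "s\<^sup>2 \<le> (b - a)\<^sup>2 * (x - c)\<^sup>2"
        using \<open>0 < s\<close> power_mono[of s "(b - a) * \<bar>x - c\<bar>" 2] by (simp add: power_mult_distrib)
      have "\<bar>bump \<delta> a b r n x\<bar> = \<bar>poly r x\<bar> / s ^ n * exp (- \<delta> / s)"
        using True \<open>0 < s\<close> by (simp add: bump_def s_def[symmetric] abs_mult)
      also have "\<dots> \<le> R / s ^ n * (L * s ^ (n + 2))"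
        using True \<open>0 < s\<close> assms R exp_minus_inverse_le[of s \<delta> "n + 2"] unfolding L_def
        by (intro mult_mono divide_right_mono) auto
      also have "\<dots> = R * L * s\<^sup>2"
        using \<open>0 < s\<close> by (simp add: power_add power2_eq_square)
      also have "\<dots> \<le> R * L * ((b - a)\<^sup>2 * (x - c)\<^sup>2)"
        using s2 R \<open>0 \<le> L\<close> by (intro mult_left_mono) auto
      finally show ?thesis by (simp add: mult.assoc)
    next
      case False
      then have "bump \<delta> a b r n x = 0" unfolding bump_def by (rule if_not_P)
      then show ?thesis using R \<open>0 \<le> L\<close> by simp
    qed
  qed
qed

text \<open>For p = (x - a) (b - x) the exponent - \<delta> / p has derivative \<delta> p' / p^2, so
  each differentiation raises the order of the pole by two, and the numerator collects the terms of
  the product rule over p^(n + 2). At the endpoints the derivative is zero, in agreement with the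
  \<open>else\<close> branch.\<close>

lemma has_real_derivative_bump:
  assumes "0 < \<delta>" "a < b"
  defines "p \<equiv> [:- a, 1:] * [:b, - 1:]"
  shows "(bump \<delta> a b r n has_real_derivative
           bump \<delta> a b (pderiv r * p\<^sup>2 - of_nat n * pderiv p * r * p + smult \<delta> (pderiv p * r)) (n + 2) x)
         (at x)"
proof -
  let ?q = "pderiv r * p\<^sup>2 - of_nat n * pderiv p * r * p + smult \<delta> (pderiv p * r)"
  consider "a < x \<and> x < b" | "x = a \<or> x = b" | "x < a \<or> b < x" using assms by linarith
  then show ?thesis
  proof cases
    case 1
    have p: "poly p y = (y - a) * (b - y)" for y by (simp add: p_def algebra_simps)
    have pos: "0 < poly p x" using 1 by (simp add: p)
    have "((\<lambda>y. poly r y / (poly p y) ^ n * exp (- \<delta> / poly p y)) has_real_derivative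
        poly ?q x / poly p x ^ (n + 2) * exp (- \<delta> / poly p x)) (at x)"
      apply (rule derivative_eq_intros poly_DERIV refl | (use pos in simp; fail))+
      using pos
      apply (cases n)
      apply (auto simp: field_simps power2_eq_square)
      done
    then have "((\<lambda>y. poly r y / (poly p y) ^ n * exp (- \<delta> / poly p y)) has_real_derivative
        bump \<delta> a b ?q (n + 2) x) (at x)"
      using 1 by (simp only: bump_def p[symmetric] simp_thms if_True)
    then show ?thesis
    proof (rule has_field_derivative_transform_within_open[of _ _ _ "{a<..<b}"])
      show "poly r y / (poly p y) ^ n * exp (- \<delta> / poly p y) = bump \<delta> a b r n y"
        if "y \<in> {a<..<b}" for y
        using that by (simp add: bump_def p)
    qed (use 1 in auto)
  next
    case 2
    obtain K where "\<And>y. \<bar>bump \<delta> a b r n y\<bar> \<le> K * (y - x)\<^sup>2"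
      using bump_quadratic_bound[OF assms(1,2), of x] 2 by metis
    then have "(bump \<delta> a b r n has_real_derivative 0) (at x)"
      by (rule DERIV_zero_of_quadratic_bound)
    then show ?thesis using 2 by (auto simp: bump_def)
  next
    case 3
    have "((\<lambda>_. 0) has_real_derivative bump \<delta> a b ?q (n + 2) x) (at x)"
      using 3 by (auto simp: bump_def)
    then show ?thesis
      by (rule has_field_derivative_transform_within_open[of _ _ _ "{..<a} \<union> {b<..}"])
         (use 3 in \<open>auto simp: bump_def\<close>)
  qed
qed

lemma deriv_funpow_bump:
  assumes "0 < \<delta>" "a < b"
  shows "\<exists>r' n'. (deriv ^^ k) (bump \<delta> a b r n) = bump \<delta> a b r' n'"
proof (induction k arbitrary: r n)
  case (Suc k)
  have "\<exists>r' n'. deriv (bump \<delta> a b r n) = bump \<delta> a b r' n'"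
    using DERIV_imp_deriv[OF has_real_derivative_bump[OF assms]] by blast
  then obtain r' n' where "deriv (bump \<delta> a b r n) = bump \<delta> a b r' n'" by blast
  then show ?case using Suc[of r' n'] by (simp only: funpow_Suc_right o_apply)
qed auto

section \<open>Supports, primitives and linear combinations of test functions\<close>

lemma test_functionsI:
  assumes "\<And>k x. (deriv ^^ k) \<phi> field_differentiable (at x)"
    and "0 < a" "b < \<epsilon>" "\<And>x. x \<notin> {a..b} \<Longrightarrow> \<phi> x = 0"
  shows "\<phi> \<in> test_functions {0<..<\<epsilon>}"
proof -
  have "{x. \<phi> x \<noteq> 0} \<subseteq> {a..b}" using assms(4) by blast
  then have *: "closure {x. \<phi> x \<noteq> 0} \<subseteq> {a..b}" by (rule closure_minimal) auto
  then have "compact (closure {x. \<phi> x \<noteq> 0})"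
    by (meson closed_closure compact_Icc compact_closure bounded_closed_interval bounded_subset closure_subset order_trans)
  with * show ?thesis using assms by (auto simp: test_functions_def)
qed

lemma test_functionsD:
  assumes "\<phi> \<in> test_functions {0<..<\<epsilon>}"
  shows "(deriv ^^ k) \<phi> field_differentiable (at x)"
    and "0 < \<epsilon> \<Longrightarrow> \<exists>a b. 0 < a \<and> a \<le> b \<and> b < \<epsilon> \<and> (\<forall>x. x \<notin> {a..b} \<longrightarrow> \<phi> x = 0)"
proof -
  show "(deriv ^^ k) \<phi> field_differentiable (at x)"
    using assms unfolding test_functions_def by blast
  let ?K = "closure {x. \<phi> x \<noteq> 0}"
  have K: "compact ?K" "?K \<subseteq> {0<..<\<epsilon>}" using assms by (auto simp: test_functions_def)
  assume "0 < \<epsilon>"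
  show "\<exists>a b. 0 < a \<and> a \<le> b \<and> b < \<epsilon> \<and> (\<forall>x. x \<notin> {a..b} \<longrightarrow> \<phi> x = 0)"
  proof (cases "?K = {}")
    case True
    then have "\<phi> x = 0" for x by (metis (mono_tags) closure_eq_empty empty_Collect_eq)
    \<comment> \<open>The zero function has no extremal points of support, so the degenerate
      interval at the midpoint serves for it.\<close>
    then show ?thesis using \<open>0 < \<epsilon>\<close> by (intro exI[of _ "\<epsilon>/2"]) auto
  next
    case False
    obtain a where a: "a \<in> ?K" "\<forall>x\<in>?K. a \<le> x" using compact_attains_inf[OF K(1) False] by blast
    obtain b where b: "b \<in> ?K" "\<forall>x\<in>?K. x \<le> b" using compact_attains_sup[OF K(1) False] by blast
    have "x \<in> ?K" if "\<phi> x \<noteq> 0" for x using that closure_subset by fastforce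
    then have "\<phi> x = 0" if "x \<notin> {a..b}" for x using a b that by fastforce
    moreover have "0 < a" "b < \<epsilon>" "a \<le> b" using a b K by auto
    ultimately show ?thesis by blast
  qed
qed

lemma bump_test_function:
  assumes "0 < \<delta>" "0 < a" "a < b" "b < \<epsilon>"
  shows "bump \<delta> a b r n \<in> test_functions {0<..<\<epsilon>}"
proof (rule test_functionsI[OF _ assms(2,4)])
  fix k x
  show "(deriv ^^ k) (bump \<delta> a b r n) field_differentiable (at x)"
    using deriv_funpow_bump[OF assms(1,3), of k r n] has_real_derivative_bump[OF assms(1,3)]
    unfolding field_differentiable_def by metis
qed (auto simp: bump_def)

lemma test_function_derivative:
  assumes "\<phi> \<in> test_functions S"
  shows "(\<phi> has_real_derivative deriv \<phi> x) (at x)"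
  using assms field_differentiable_derivI[of \<phi> x]
  unfolding test_functions_def by (metis (mono_tags, lifting) funpow_0 mem_Collect_eq)

lemma deriv_test_function:
  assumes "\<phi> \<in> test_functions {0<..<\<epsilon>}" "0 < \<epsilon>"
  shows "deriv \<phi> \<in> test_functions {0<..<\<epsilon>}"
proof -
  obtain a b where ab: "0 < a" "a \<le> b" "b < \<epsilon>" "\<forall>x. x \<notin> {a..b} \<longrightarrow> \<phi> x = 0"
    using test_functionsD(2)[OF assms] by blast
  show ?thesis
  proof (rule test_functionsI[OF _ ab(1,3)])
    fix k x
    show "(deriv ^^ k) (deriv \<phi>) field_differentiable (at x)"
      using test_functionsD(1)[OF assms(1), of "Suc k"] by (simp only: funpow_Suc_right o_apply)
  next
    fix x assume x: "x \<notin> {a..b}"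
    have "((\<lambda>_. 0) has_real_derivative 0) (at x)" by simp
    then have "(\<phi> has_real_derivative 0) (at x)"
      by (rule has_field_derivative_transform_within_open[of _ _ _ "- {a..b}"]) (use x ab in auto)
    then show "deriv \<phi> x = 0" by (rule DERIV_imp_deriv)
  qed
qed

lemma continuous_on_test_function:
  assumes "\<phi> \<in> test_functions S"
  shows "continuous_on A \<phi>"
  by (meson DERIV_isCont assms continuous_at_imp_continuous_on test_function_derivative)

lemma deriv_funpow_linear:
  fixes f g :: "real \<Rightarrow> real"
  assumes "\<And>k x. (deriv ^^ k) f field_differentiable (at x)"
    and "\<And>k x. (deriv ^^ k) g field_differentiable (at x)"
  shows "(deriv ^^ k) (\<lambda>x. f x - c * g x) = (\<lambda>x. (deriv ^^ k) f x - c * (deriv ^^ k) g x)"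
proof (induction k)
  case (Suc k)
  have "deriv (\<lambda>x. (deriv ^^ k) f x - c * (deriv ^^ k) g x) x
      = deriv ((deriv ^^ k) f) x - c * deriv ((deriv ^^ k) g) x" for x
    using assms by (subst deriv_diff) (auto intro!: derivative_intros simp: deriv_cmult field_differentiable_mult)
  then show ?case using Suc by auto
qed auto

text \<open>Of this form is the correction that makes the integral of a test function zero: a
  suitable multiple of a fixed test function is subtracted.\<close>

lemma test_functions_linear:
  assumes "\<phi> \<in> test_functions {0<..<\<epsilon>}" "\<rho> \<in> test_functions {0<..<\<epsilon>}" "0 < \<epsilon>"
  shows "(\<lambda>x. \<phi> x - c * \<rho> x) \<in> test_functions {0<..<\<epsilon>}"
proof -
  obtain a b where ab: "0 < a" "a \<le> b" "b < \<epsilon>" "\<forall>x. x \<notin> {a..b} \<longrightarrow> \<phi> x = 0"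
    using test_functionsD(2)[OF assms(1,3)] by blast
  obtain a' b' where ab': "0 < a'" "a' \<le> b'" "b' < \<epsilon>" "\<forall>x. x \<notin> {a'..b'} \<longrightarrow> \<rho> x = 0"
    using test_functionsD(2)[OF assms(2,3)] by blast
  show ?thesis
  proof (rule test_functionsI[of _ "min a a'" "max b b'"])
    fix k x
    show "(deriv ^^ k) (\<lambda>x. \<phi> x - c * \<rho> x) field_differentiable (at x)"
      using test_functionsD(1)[OF assms(1)] test_functionsD(1)[OF assms(2)]
      by (subst deriv_funpow_linear) (auto intro!: derivative_intros)
  next
    fix x assume "x \<notin> {min a a'..max b b'}"
    then have "x \<notin> {a..b}" "x \<notin> {a'..b'}" by auto
    then show "\<phi> x - c * \<rho> x = 0" using ab(4) ab'(4) by simp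
  qed (use ab ab' in auto)
qed

text \<open>The primitive that starts at 0 vanishes to the left of the support of \<psi> and equals
  the total integral to the right of it; integral zero is what keeps the primitive compactly
  supported in the interval.\<close>

lemma test_function_antiderivative:
  assumes "\<psi> \<in> test_functions {0<..<\<epsilon>}" "0 < \<epsilon>" "integral {0..\<epsilon>} \<psi> = 0"
  obtains \<phi> where "\<phi> \<in> test_functions {0<..<\<epsilon>}" "deriv \<phi> = \<psi>"
proof -
  obtain a b where ab: "0 < a" "a \<le> b" "b < \<epsilon>" "\<forall>x. x \<notin> {a..b} \<longrightarrow> \<psi> x = 0"
    using test_functionsD(2)[OF assms(1,2)] by blast
  define \<phi> where "\<phi> x = integral {0..x} \<psi>" for x
  have int: "\<psi> integrable_on {c..d}" for c d
    by (intro integrable_continuous_real continuous_on_test_function[OF assms(1)])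
  \<comment> \<open>For negative x the interval \<open>{0..x}\<close> is empty and its integral is 0
    by convention, so this covers all x below a.\<close>
  have left: "\<phi> x = 0" if "x < a" for x
    unfolding \<phi>_def using ab that
    by (subst Henstock_Kurzweil_Integration.integral_cong[where g = "\<lambda>_. 0"]) auto
  have right: "\<phi> x = 0" if "b < x" for x
  proof -
    have *: "integral {0..y} \<psi> = integral {0..b} \<psi>" if "b < y" for y
    proof -
      \<comment> \<open>\<psi> is known to vanish only outside [a, b], so the point b is discarded
        as a null set.\<close>
      have "integral {b..y} \<psi> = integral {b..y} (\<lambda>_. 0)"
        using ab by (intro integral_spike[of "{b}"]) auto
      then show ?thesis
        using Henstock_Kurzweil_Integration.integral_combine[of 0 b y \<psi>] int ab that by auto
    qed
    show ?thesis
      unfolding \<phi>_def using *[OF that] *[OF ab(3)] assms(3) by simp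
  qed
  have D: "(\<phi> has_real_derivative \<psi> x) (at x)" for x
  proof (cases "0 < x")
    case True
    have "(\<phi> has_vector_derivative \<psi> x) (at x within {0..x+1})"
      unfolding \<phi>_def using True
      by (intro integral_has_vector_derivative continuous_on_test_function[OF assms(1)]) auto
    moreover have "at x within {0..x+1} = at x"
      using True by (intro at_within_interior) auto
    ultimately show ?thesis by (simp add: has_real_derivative_iff_has_vector_derivative)
  next
    case False
    have "((\<lambda>_. 0) has_real_derivative \<psi> x) (at x)" using ab False by auto
    then show ?thesis
      by (rule has_field_derivative_transform_within_open[of _ _ _ "{..<a}"])
         (use False ab left in auto)
  qed
  then have deriv: "deriv \<phi> = \<psi>" by (blast intro: DERIV_imp_deriv)
  have "\<phi> \<in> test_functions {0<..<\<epsilon>}"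
  proof (rule test_functionsI[OF _ ab(1,3)])
    fix k x
    show "(deriv ^^ k) \<phi> field_differentiable (at x)"
    proof (cases k)
      case 0
      then show ?thesis using D by (auto simp: field_differentiable_def)
    next
      case (Suc m)
      then show ?thesis
        using test_functionsD(1)[OF assms(1), of m x] by (simp only: funpow_Suc_right o_apply deriv)
    qed
  qed (use left right in \<open>force simp: not_le\<close>)
  then show thesis using deriv that by blast
qed

section \<open>Integrability and integrals on a bounded open interval\<close>

lemma finite_measure_open_interval: "finite_measure (lebesgue_on {a<..<b::real})"
  by (intro finite_measure_lebesgue_on) auto

lemma measurable_continuous_open_interval:
  fixes g :: "real \<Rightarrow> 'a::euclidean_space"
  assumes "continuous_on {a..b} g"
  shows "g \<in> borel_measurable (lebesgue_on {a<..<b})"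
  using assms by (intro continuous_imp_measurable_on_sets_lebesgue) (auto intro: continuous_on_subset)

lemma integrable_continuous_mult:
  fixes f g :: "real \<Rightarrow> complex"
  assumes "continuous_on {a..b} g" "integrable (lebesgue_on {a<..<b}) f"
  shows "integrable (lebesgue_on {a<..<b}) (\<lambda>x. g x * f x)"
proof -
  have "bounded (g ` {a..b})"
    by (intro compact_imp_bounded compact_continuous_image assms compact_Icc)
  then obtain B where B: "\<And>x. x \<in> {a..b} \<Longrightarrow> norm (g x) \<le> B" "0 < B"
    unfolding bounded_pos by (metis imageI)
  show ?thesis
  proof (rule Bochner_Integration.integrable_bound)
    show "integrable (lebesgue_on {a<..<b}) (\<lambda>x. of_real B * f x)" using assms by simp
    show "(\<lambda>x. g x * f x) \<in> borel_measurable (lebesgue_on {a<..<b})"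
      using assms(2) by (intro borel_measurable_times measurable_continuous_open_interval[OF assms(1)]) auto
    show "AE x in lebesgue_on {a<..<b}. norm (g x * f x) \<le> norm (of_real B * f x)"
      using B by (intro AE_I2) (auto simp: norm_mult intro!: mult_right_mono)
  qed
qed

lemma integrable_continuous_scaleR:
  fixes f :: "real \<Rightarrow> complex"
  assumes "continuous_on {a..b} g" "integrable (lebesgue_on {a<..<b}) f"
  shows "integrable (lebesgue_on {a<..<b}) (\<lambda>x. g x *\<^sub>R f x)"
  unfolding scaleR_conv_of_real using assms
  by (intro integrable_continuous_mult continuous_intros)

lemma integrable_continuous_open_interval:
  fixes g :: "real \<Rightarrow> complex"
  assumes "continuous_on {a..b} g"
  shows "integrable (lebesgue_on {a<..<b}) g"
proof -
  interpret finite_measure "lebesgue_on {a<..<b}" by (rule finite_measure_open_interval)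
  show ?thesis using integrable_continuous_mult[OF assms, of "\<lambda>_. 1"] by simp
qed

lemma integral_continuous_open_interval:
  fixes g :: "real \<Rightarrow> complex"
  assumes "continuous_on {a..b} g"
  shows "integral\<^sup>L (lebesgue_on {a<..<b}) g = integral {a..b} g"
  using lebesgue_integral_eq_integral[OF integrable_continuous_open_interval[OF assms]]
    integral_open_interval[of a b g]
  by simp

lemma integrable_of_L2:
  assumes "f \<in> L2 (lebesgue_on {a<..<b::real})"
  shows "integrable (lebesgue_on {a<..<b}) f"
proof -
  interpret finite_measure "lebesgue_on {a<..<b}" by (rule finite_measure_open_interval)
  have f: "f \<in> borel_measurable (lebesgue_on {a<..<b})"
      "integrable (lebesgue_on {a<..<b}) (\<lambda>x. (cmod (f x))\<^sup>2)"
    using assms by (auto simp: L2_def)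
  have "integrable (lebesgue_on {a<..<b}) (\<lambda>x. cmod (f x))"
    by (rule square_integrable_imp_integrable[OF measurable_compose[OF f(1) borel_measurable_norm] f(2)])
  then show ?thesis using f(1) by (rule integrable_norm_cancel)
qed

section \<open>The fundamental lemma of the calculus of variations\<close>

text \<open>Dominated convergence along bumps that exhaust (0, c): both ends are moved inward by c /
  (i + 3), where the 3 keeps this below c / 2, and \<delta> = 1 / (i + 1) tends to 0, so that the
  exponential tends to 1. All these bumps are bounded by 1. On (0, \<epsilon>) the indicator of
  \<open>{..<c}\<close> is that of (0, c).\<close>

lemma integral_lessThan_eq_zero:
  fixes f :: "real \<Rightarrow> complex"
  assumes f: "integrable (lebesgue_on {0<..<\<epsilon>}) f"
    and zero: "\<And>\<phi>. \<phi> \<in> test_functions {0<..<\<epsilon>} \<Longrightarrow> (\<integral>x. \<phi> x *\<^sub>R f x \<partial>lebesgue_on {0<..<\<epsilon>}) = 0"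
    and c: "0 < c" "c \<le> \<epsilon>"
  shows "(\<integral>x. indicator {..<c} x *\<^sub>R f x \<partial>lebesgue_on {0<..<\<epsilon>}) = 0"
proof -
  define \<phi> where "\<phi> i = bump (1 / (real i + 1)) (c / (real i + 3)) (c - c / (real i + 3)) 1 0" for i
  have test: "\<phi> i \<in> test_functions {0<..<\<epsilon>}" for i
  proof -
    have "0 < c / (real i + 3)" "c / (real i + 3) < c / 2"
      using c divide_strict_left_mono[of 2 "real i + 3" c] by auto
    then have "c / (real i + 3) < c - c / (real i + 3)" "c - c / (real i + 3) < \<epsilon>"
      using c by linarith+
    then show ?thesis unfolding \<phi>_def using c by (intro bump_test_function) auto
  qed
  have lim: "(\<lambda>i. \<phi> i x) \<longlonglongrightarrow> indicator {..<c} x" if "x \<in> {0<..<\<epsilon>}" for x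
  proof (cases "x < c")
    case True
    have a: "(\<lambda>i. c / (real i + 3)) \<longlonglongrightarrow> 0"
      using LIMSEQ_ignore_initial_segment[OF lim_const_over_n[of c], of 3] by simp
    have b: "(\<lambda>i. c - c / (real i + 3)) \<longlonglongrightarrow> c"
      using tendsto_diff[OF tendsto_const a, of c] by simp
    have d: "(\<lambda>i. - (1 / (real i + 1))) \<longlonglongrightarrow> - 0"
      using LIMSEQ_ignore_initial_segment[OF lim_const_over_n[of "1::real"], of 1]
      by (intro tendsto_minus) (simp add: add.commute)
    have "(\<lambda>i. exp (- (1 / (real i + 1)) / ((x - c / (real i + 3)) * (c - c / (real i + 3) - x))))
        \<longlonglongrightarrow> exp (- 0 / ((x - 0) * (c - x)))"
      using True that by (intro tendsto_intros a b d) auto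
    moreover have "\<forall>\<^sub>F i in sequentially. \<phi> i x =
        exp (- (1 / (real i + 1)) / ((x - c / (real i + 3)) * (c - c / (real i + 3) - x)))"
      using order_tendstoD(2)[OF a, of x, OF greaterThanLessThan_iff[THEN iffD1, THEN conjunct1, OF that]]
        order_tendstoD(1)[OF b True]
      by eventually_elim (simp add: \<phi>_def bump_def)
    ultimately show ?thesis
      using True by (simp add: tendsto_cong)
  next
    case False
    have "0 < c / (real i + 3)" for i using c by simp
    then have "\<not> x < c - c / (real i + 3)" for i using False by (smt (verit))
    then have "\<phi> i x = 0" for i by (simp add: \<phi>_def bump_def)
    then show ?thesis using False by simp
  qed
  have "(\<lambda>i. \<integral>x. \<phi> i x *\<^sub>R f x \<partial>lebesgue_on {0<..<\<epsilon>})
      \<longlonglongrightarrow> (\<integral>x. indicator {..<c} x *\<^sub>R f x \<partial>lebesgue_on {0<..<\<epsilon>})"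
  proof (rule integral_dominated_convergence[where w = "\<lambda>x. norm (f x)"])
    show "(\<lambda>x. indicat_real {..<c} x *\<^sub>R f x) \<in> borel_measurable (lebesgue_on {0<..<\<epsilon>})"
      using f by (intro borel_measurable_scaleR borel_measurable_indicator')
                 (auto simp: sets_restrict_space)
    show "(\<lambda>x. \<phi> i x *\<^sub>R f x) \<in> borel_measurable (lebesgue_on {0<..<\<epsilon>})" for i
      using f continuous_on_test_function[OF test]
      by (intro borel_measurable_integrable integrable_continuous_scaleR)
    show "AE x in lebesgue_on {0<..<\<epsilon>}. (\<lambda>i. \<phi> i x *\<^sub>R f x) \<longlonglongrightarrow> indicat_real {..<c} x *\<^sub>R f x"
      using lim by (intro AE_I2 tendsto_intros) auto
    have "\<bar>\<phi> i x\<bar> \<le> 1" for i x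
      by (auto simp: \<phi>_def bump_def divide_simps)
    then show "AE x in lebesgue_on {0<..<\<epsilon>}. norm (\<phi> i x *\<^sub>R f x) \<le> norm (f x)" for i
      by (intro AE_I2) (simp add: mult_left_le_one_le)
  qed (use f in auto)
  then show ?thesis using zero[OF test] by (simp add: LIMSEQ_const_iff)
qed

lemma Int_lessThan_min: "{..<a} \<inter> {..<b} = {..<min a b}" for a b :: "'a::linorder"
  by auto

text \<open>The sets over which \<open>f\<close> integrates to zero form a Dynkin system.\<close>

lemma fundamental_lemma:
  fixes f :: "real \<Rightarrow> complex"
  assumes f: "integrable (lebesgue_on {0<..<\<epsilon>}) f"
    and zero: "\<And>\<phi>. \<phi> \<in> test_functions {0<..<\<epsilon>} \<Longrightarrow> (\<integral>x. \<phi> x *\<^sub>R f x \<partial>lebesgue_on {0<..<\<epsilon>}) = 0"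
    and "0 < \<epsilon>"
  shows "AE x in lebesgue_on {0<..<\<epsilon>}. f x = 0"
proof -
  let ?S = "{0<..<\<epsilon>}" and ?M = "lebesgue_on {0<..<\<epsilon>}"
  \<comment> \<open>Extension by zero moves the argument to the whole line, where the half-lines
    \<open>{..<c}\<close> generate the Borel sets.\<close>
  define F where "F x = (if x \<in> ?S then f x else 0)" for x
  have F: "integrable lebesgue F"
    unfolding F_def by (rule Lebesgue_Measure.integrable_restrict_UNIV[THEN iffD2, OF _ f]) auto
  have Fset: "set_integrable lebesgue A F" if "A \<in> sets lebesgue" for A
    using F that by (simp add: set_integrable_def integrable_mult_indicator)
  have restrict: "set_lebesgue_integral lebesgue A F = (\<integral>x. indicator A x *\<^sub>R f x \<partial>?M)" for A
  proof -
    have "(\<lambda>x. indicat_real A x *\<^sub>R F x) = (\<lambda>x. if x \<in> ?S then indicat_real A x *\<^sub>R f x else 0)"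
      by (auto simp: F_def)
    then show ?thesis
      unfolding set_lebesgue_integral_def using Lebesgue_Measure.integral_restrict_UNIV[of ?S "\<lambda>x. indicat_real A x *\<^sub>R f x"] by simp
  qed
  have lt: "set_lebesgue_integral lebesgue {..<c} F = 0" for c
  proof (cases "0 < c")
    case True
    have "(\<integral>x. indicat_real {..<c} x *\<^sub>R f x \<partial>?M) = (\<integral>x. indicat_real {..<min c \<epsilon>} x *\<^sub>R f x \<partial>?M)"
      by (intro Bochner_Integration.integral_cong) (auto simp: indicator_def)
    then show ?thesis
      using integral_lessThan_eq_zero[OF f zero, of "min c \<epsilon>"] True assms restrict by simp
  next
    case False
    then show ?thesis
      unfolding set_lebesgue_integral_def
      by (intro integral_eq_zero_AE AE_I2) (auto simp: F_def)
  qed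
  \<comment> \<open>The half-lines are written with \<open>eucl_less\<close> to match the generator
    of the Borel sets of a Euclidean space.\<close>
  let ?G = "range (\<lambda>c::real. {x. eucl_less x c})"
  have G: "{x. eucl_less x c} = {..<c}" for c :: real by (auto simp: eucl_less_def)
  have borel: "sets borel = sigma_sets UNIV ?G"
    by (subst borel_eq_lessThan) (simp add: sets_measure_of)
  have leb: "A \<in> sets lebesgue" if "A \<in> sets borel" for A :: "real set"
    using that by auto
  have int_borel: "set_lebesgue_integral lebesgue A F = 0" if "A \<in> sets borel" for A
  proof -
    have "Int_stable ?G"
      unfolding G Int_stable_def by (auto simp: Int_lessThan_min)
    moreover have "?G \<subseteq> Pow UNIV" by simp
    moreover have "A \<in> sigma_sets UNIV ?G" using that borel by simp
    ultimately show ?thesis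
    proof (induction rule: sigma_sets_induct_disjoint)
      case (basic A)
      then show ?case using lt G by auto
    next
      case (compl A)
      have "A \<in> sets lebesgue" using compl(1) borel leb by simp
      then have "set_lebesgue_integral lebesgue (A \<union> (UNIV - A)) F
          = set_lebesgue_integral lebesgue A F + set_lebesgue_integral lebesgue (UNIV - A) F"
        by (intro set_integral_Un Fset) auto
      \<comment> \<open>As \<open>F\<close> vanishes outside the interval, its total integral is the
        one over \<open>{..<\<epsilon>}\<close>, which is already known to be zero.\<close>
      moreover have "set_lebesgue_integral lebesgue (A \<union> (UNIV - A)) F = set_lebesgue_integral lebesgue {..<\<epsilon>} F"
        unfolding set_lebesgue_integral_def
        by (intro Bochner_Integration.integral_cong) (auto simp: F_def indicator_def)
      ultimately show ?case using lt compl(2) by simp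
    next
      case (union A)
      have "A i \<in> sets lebesgue" for i using union(2) borel leb by blast
      then have "set_lebesgue_integral lebesgue (\<Union>i. A i) F = (\<Sum>i. set_lebesgue_integral lebesgue (A i) F)"
        using union(1) by (intro lebesgue_integral_countable_add Fset) (auto simp: disjoint_family_on_def)
      then show ?case using union(3) by simp
    qed (simp add: set_lebesgue_integral_def)
  qed
  have int_lebesgue: "set_lebesgue_integral lebesgue A F = 0" if A: "A \<in> sets lebesgue" for A
  proof -
    obtain B N where BN: "B \<in> sets borel" "negligible N" "B \<union> N = A"
      using sets_lebesgue_almost_borel[OF A] by metis
    have "set_lebesgue_integral lebesgue A F = set_lebesgue_integral lebesgue B F"
    proof (rule set_integral_null_delta[OF F A leb[OF BN(1)]])
      have "negligible ((A - B) \<union> (B - A))"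
        using BN by (auto intro: negligible_subset)
      then show "(A - B) \<union> (B - A) \<in> null_sets lebesgue" by (simp add: negligible_iff_null_sets)
    qed
    then show ?thesis using int_borel BN by simp
  qed
  interpret finite_measure ?M by (rule finite_measure_open_interval)
  show ?thesis
  proof (rule density_zero[OF f])
    fix A assume "A \<in> sets ?M"
    then have "A \<in> sets lebesgue" by (auto simp: sets_restrict_space)
    then show "set_lebesgue_integral ?M A f = 0"
      using int_lebesgue restrict by (simp add: set_lebesgue_integral_def)
  qed
qed

section \<open>Integration by parts and the du Bois-Reymond lemma\<close>

text \<open>The cut-off serves two purposes: t = 0 gives the integral over the whole interval, and t
  inside it gives the inner integrals that arise when a Volterra operator is moved to a test
  function.\<close>

lemma integral_greaterThan_FTC:
  fixes A a :: "real \<Rightarrow> complex"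
  assumes "\<And>x. (A has_vector_derivative a x) (at x)" "continuous_on UNIV a" "0 \<le> t" "t \<le> \<epsilon>"
  shows "(\<integral>x. (if t < x then a x else 0) \<partial>lebesgue_on {0<..<\<epsilon>}) = A \<epsilon> - A t"
proof -
  have "(\<integral>x. (if t < x then a x else 0) \<partial>lebesgue_on {0<..<\<epsilon>})
      = (\<integral>x. (if x \<in> {t<..<\<epsilon>} then a x else 0) \<partial>lebesgue_on {0<..<\<epsilon>})"
    by (intro Bochner_Integration.integral_cong) auto
  also have "\<dots> = (\<integral>x. a x \<partial>lebesgue_on {t<..<\<epsilon>})"
    using assms by (intro integral_restrict) auto
  also have "\<dots> = integral {t..\<epsilon>} a"
    by (intro integral_continuous_open_interval continuous_on_subset[OF assms(2)]) auto
  also have "\<dots> = A \<epsilon> - A t"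
    using assms by (intro integral_unique fundamental_theorem_of_calculus)
      (auto intro: has_vector_derivative_at_within)
  finally show ?thesis .
qed

lemma has_vector_derivative_test_function_scaleR:
  assumes "\<phi> \<in> test_functions S" "(K has_vector_derivative K') (at x)"
  shows "((\<lambda>x. \<phi> x *\<^sub>R K x) has_vector_derivative deriv \<phi> x *\<^sub>R K x + \<phi> x *\<^sub>R K') (at x)"
  using has_vector_derivative_scaleR[OF test_function_derivative[OF assms(1)] assms(2)]
  by (simp add: add.commute)

lemma test_function_boundary:
  assumes "\<phi> \<in> test_functions {0<..<\<epsilon>}" "0 < \<epsilon>"
  shows "\<phi> 0 = 0" "\<phi> \<epsilon> = 0"
  using test_functionsD(2)[OF assms] by auto

text \<open>The fundamental theorem is applied to \<phi> K, whose values at both ends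
  vanish.\<close>

lemma integral_by_parts_test_function:
  fixes K K' :: "real \<Rightarrow> complex"
  assumes "\<phi> \<in> test_functions {0<..<\<epsilon>}" "0 < \<epsilon>"
    and K: "\<And>x. (K has_vector_derivative K' x) (at x)" "continuous_on UNIV K'"
  shows "(\<integral>x. deriv \<phi> x *\<^sub>R K x \<partial>lebesgue_on {0<..<\<epsilon>})
       = - (\<integral>x. \<phi> x *\<^sub>R K' x \<partial>lebesgue_on {0<..<\<epsilon>})"
proof -
  have cK: "continuous_on A K" for A
    using K(1) by (meson continuous_at_imp_continuous_on has_vector_derivative_continuous)
  have c: "continuous_on A \<phi>" "continuous_on A (deriv \<phi>)" "continuous_on A K'" for A
    using continuous_on_test_function assms(1) deriv_test_function[OF assms(1,2)] K(2)
    by (blast intro: continuous_on_subset)+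
  let ?M = "lebesgue_on {0<..<\<epsilon>}"
  have "(\<integral>x. deriv \<phi> x *\<^sub>R K x \<partial>?M) + (\<integral>x. \<phi> x *\<^sub>R K' x \<partial>?M)
      = (\<integral>x. deriv \<phi> x *\<^sub>R K x + \<phi> x *\<^sub>R K' x \<partial>?M)"
    by (intro Bochner_Integration.integral_add[symmetric] integrable_continuous_open_interval continuous_intros c cK)
  also have "\<dots> = (\<integral>x. (if 0 < x then deriv \<phi> x *\<^sub>R K x + \<phi> x *\<^sub>R K' x else 0) \<partial>?M)"
    by (intro Bochner_Integration.integral_cong) auto
  also have "\<dots> = \<phi> \<epsilon> *\<^sub>R K \<epsilon> - \<phi> 0 *\<^sub>R K 0"
    using assms by (intro integral_greaterThan_FTC has_vector_derivative_test_function_scaleR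
        continuous_intros c cK) auto
  finally show ?thesis
    using test_function_boundary[OF assms(1,2)] by (simp add: eq_neg_iff_add_eq_0)
qed

lemma integral_of_real_test_function:
  assumes "\<psi> \<in> test_functions {0<..<\<epsilon>}"
  shows "(\<integral>x. \<psi> x *\<^sub>R c \<partial>lebesgue_on {0<..<\<epsilon>}) = of_real (integral {0..\<epsilon>} \<psi>) * (c::complex)"
proof -
  have "(\<integral>x. \<psi> x *\<^sub>R c \<partial>lebesgue_on {0<..<\<epsilon>}) = integral {0..\<epsilon>} (\<lambda>x. \<psi> x *\<^sub>R c)"
    using assms by (intro integral_continuous_open_interval continuous_intros continuous_on_test_function)
  also have "\<dots> = integral {0..\<epsilon>} \<psi> *\<^sub>R c"
    using integrable_continuous_real[OF continuous_on_test_function[OF assms]]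
    by (intro integral_unique has_integral_scaleR_left integrable_integral)
  finally show ?thesis by (simp add: scaleR_conv_of_real)
qed

text \<open>A test function with integral zero is the derivative of a test function, so
  \<open>L\<close> factors through the integral. Any \<rho> with nonzero integral m determines the
  factor, since \<psi> minus the multiple of \<rho> with the same integral is killed by
  \<open>L\<close>. The functional is abstract because it occurs in two forms: integration of \<psi>
  f and of \<psi>' f.\<close>

lemma functional_vanishing_on_derivatives:
  fixes L :: "(real \<Rightarrow> real) \<Rightarrow> complex"
  assumes "0 < \<epsilon>"
    and linear: "\<And>\<psi> \<rho> c. \<psi> \<in> test_functions {0<..<\<epsilon>} \<Longrightarrow> \<rho> \<in> test_functions {0<..<\<epsilon>} \<Longrightarrow>
        L (\<lambda>x. \<psi> x - c * \<rho> x) = L \<psi> - of_real c * L \<rho>"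
    and zero: "\<And>\<phi>. \<phi> \<in> test_functions {0<..<\<epsilon>} \<Longrightarrow> L (deriv \<phi>) = 0"
  obtains C where "\<And>\<psi>. \<psi> \<in> test_functions {0<..<\<epsilon>} \<Longrightarrow> L \<psi> = of_real (integral {0..\<epsilon>} \<psi>) * C"
proof -
  define \<rho> where "\<rho> = bump 1 (\<epsilon> / 3) (2 * \<epsilon> / 3) 1 0"
  have \<rho>: "\<rho> \<in> test_functions {0<..<\<epsilon>}"
    unfolding \<rho>_def using assms by (intro bump_test_function) auto
  define m where "m = integral {0..\<epsilon>} \<rho>"
  \<comment> \<open>\<rho> is continuous, nonnegative and nonzero at the midpoint; hence its
    integral is not zero.\<close>
  have "\<rho> (\<epsilon> / 2) \<noteq> 0" using assms by (simp add: \<rho>_def bump_def)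
  then have m: "m \<noteq> 0"
    unfolding m_def using assms
    by (subst integral_eq_0_iff[OF continuous_on_test_function[OF \<rho>]])
       (auto simp: \<rho>_def bump_def intro!: bexI[of _ "\<epsilon> / 2"])
  have int: "\<psi> integrable_on {0..\<epsilon>}" if "\<psi> \<in> test_functions {0<..<\<epsilon>}" for \<psi>
    by (intro integrable_continuous_real continuous_on_test_function[OF that])
  show thesis
  proof (rule that[of "L \<rho> / of_real m"])
    fix \<psi> assume \<psi>: "\<psi> \<in> test_functions {0<..<\<epsilon>}"
    let ?c = "integral {0..\<epsilon>} \<psi> / m"
    have "integral {0..\<epsilon>} (\<lambda>x. \<psi> x - ?c * \<rho> x) = integral {0..\<epsilon>} \<psi> - ?c * m"
      unfolding m_def
      by (subst Henstock_Kurzweil_Integration.integral_diff[OF int[OF \<psi>] integrable_on_mult_right[OF int[OF \<rho>]]]) simp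
    then have "integral {0..\<epsilon>} (\<lambda>x. \<psi> x - ?c * \<rho> x) = 0" using m by simp
    then obtain \<phi> where "\<phi> \<in> test_functions {0<..<\<epsilon>}" "deriv \<phi> = (\<lambda>x. \<psi> x - ?c * \<rho> x)"
      using test_function_antiderivative[OF test_functions_linear[OF \<psi> \<rho> assms(1)] assms(1)] by metis
    then have "L \<psi> - of_real ?c * L \<rho> = 0" using zero linear[OF \<psi> \<rho>, of ?c] by metis
    then show "L \<psi> = of_real (integral {0..\<epsilon>} \<psi>) * (L \<rho> / of_real m)" by simp
  qed
qed

text \<open>The functional that integrates \<psi> f kills derivatives, so it is integration against
  a constant C, and the fundamental lemma applies to f - C.\<close>

lemma du_Bois_Reymond:
  fixes f :: "real \<Rightarrow> complex"
  assumes "0 < \<epsilon>" and f: "integrable (lebesgue_on {0<..<\<epsilon>}) f"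
    and zero: "\<And>\<phi>. \<phi> \<in> test_functions {0<..<\<epsilon>} \<Longrightarrow>
      (\<integral>x. deriv \<phi> x *\<^sub>R f x \<partial>lebesgue_on {0<..<\<epsilon>}) = 0"
  shows "\<exists>c. AE x in lebesgue_on {0<..<\<epsilon>}. f x = c"
proof -
  let ?M = "lebesgue_on {0<..<\<epsilon>}"
  note cont = continuous_on_test_function
  note int = integrable_continuous_scaleR[OF cont f]
  obtain C where C: "\<And>\<psi>. \<psi> \<in> test_functions {0<..<\<epsilon>} \<Longrightarrow>
      (\<integral>x. \<psi> x *\<^sub>R f x \<partial>?M) = of_real (integral {0..\<epsilon>} \<psi>) * C"
  proof (rule functional_vanishing_on_derivatives[OF assms(1), of "\<lambda>\<psi>. \<integral>x. \<psi> x *\<^sub>R f x \<partial>?M"])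
    fix \<psi> \<rho> :: "real \<Rightarrow> real" and c
    assume "\<psi> \<in> test_functions {0<..<\<epsilon>}" "\<rho> \<in> test_functions {0<..<\<epsilon>}"
    then have "(\<integral>x. \<psi> x *\<^sub>R f x \<partial>?M) - (\<integral>x. of_real c * (\<rho> x *\<^sub>R f x) \<partial>?M)
        = (\<integral>x. \<psi> x *\<^sub>R f x - of_real c * (\<rho> x *\<^sub>R f x) \<partial>?M)"
      by (intro Bochner_Integration.integral_diff[symmetric] integrable_mult_right int)
    then show "(\<integral>x. (\<psi> x - c * \<rho> x) *\<^sub>R f x \<partial>?M)
        = (\<integral>x. \<psi> x *\<^sub>R f x \<partial>?M) - of_real c * (\<integral>x. \<rho> x *\<^sub>R f x \<partial>?M)"
      by (simp add: scaleR_conv_of_real algebra_simps)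
  qed (use zero in auto)
  interpret finite_measure ?M by (rule finite_measure_open_interval)
  have "AE x in ?M. f x - C = 0"
  proof (rule fundamental_lemma[OF _ _ assms(1)])
    show "integrable ?M (\<lambda>x. f x - C)" using f by simp
    fix \<psi> assume \<psi>: "\<psi> \<in> test_functions {0<..<\<epsilon>}"
    have "(\<integral>x. \<psi> x *\<^sub>R (f x - C) \<partial>?M) = (\<integral>x. \<psi> x *\<^sub>R f x \<partial>?M) - (\<integral>x. \<psi> x *\<^sub>R C \<partial>?M)"
      unfolding scaleR_diff_right
      by (intro Bochner_Integration.integral_diff int[OF \<psi>] integrable_continuous_scaleR[OF cont[OF \<psi>]] integrable_const)
    then show "(\<integral>x. \<psi> x *\<^sub>R (f x - C) \<partial>?M) = 0"
      using C[OF \<psi>] integral_of_real_test_function[OF \<psi>] by simp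
  qed
  then show ?thesis by auto
qed

text \<open>The functional that integrates \<psi>' f kills derivatives, so it is integration of
  \<psi> against a constant C. By parts, C x in place of f gives the negative of this, so f + C x
  falls under the first-order lemma.\<close>

lemma du_Bois_Reymond_second:
  fixes f :: "real \<Rightarrow> complex"
  assumes "0 < \<epsilon>" and f: "integrable (lebesgue_on {0<..<\<epsilon>}) f"
    and zero: "\<And>\<phi>. \<phi> \<in> test_functions {0<..<\<epsilon>} \<Longrightarrow>
      (\<integral>x. deriv (deriv \<phi>) x *\<^sub>R f x \<partial>lebesgue_on {0<..<\<epsilon>}) = 0"
  shows "\<exists>c d. AE x in lebesgue_on {0<..<\<epsilon>}. f x = c + d * of_real x"
proof -
  let ?M = "lebesgue_on {0<..<\<epsilon>}"
  note cont = continuous_on_test_function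
  note deriv_test = deriv_test_function[OF _ assms(1)]
  note int = integrable_continuous_scaleR[OF cont f]
  obtain C where C: "\<And>\<psi>. \<psi> \<in> test_functions {0<..<\<epsilon>} \<Longrightarrow>
      (\<integral>x. deriv \<psi> x *\<^sub>R f x \<partial>?M) = of_real (integral {0..\<epsilon>} \<psi>) * C"
  proof (rule functional_vanishing_on_derivatives[OF assms(1), of "\<lambda>\<psi>. \<integral>x. deriv \<psi> x *\<^sub>R f x \<partial>?M"])
    fix \<psi> \<rho> :: "real \<Rightarrow> real" and c
    assume t: "\<psi> \<in> test_functions {0<..<\<epsilon>}" "\<rho> \<in> test_functions {0<..<\<epsilon>}"
    have "deriv (\<lambda>x. \<psi> x - c * \<rho> x) = (\<lambda>x. deriv \<psi> x - c * deriv \<rho> x)"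
      by (intro ext DERIV_imp_deriv derivative_intros DERIV_cmult
          test_function_derivative[OF t(1)] test_function_derivative[OF t(2)])
    moreover have "(\<integral>x. deriv \<psi> x *\<^sub>R f x \<partial>?M) - (\<integral>x. of_real c * (deriv \<rho> x *\<^sub>R f x) \<partial>?M)
        = (\<integral>x. deriv \<psi> x *\<^sub>R f x - of_real c * (deriv \<rho> x *\<^sub>R f x) \<partial>?M)"
      by (intro Bochner_Integration.integral_diff[symmetric] integrable_mult_right int[OF deriv_test[OF t(1)]] int[OF deriv_test[OF t(2)]])
    ultimately show "(\<integral>x. deriv (\<lambda>x. \<psi> x - c * \<rho> x) x *\<^sub>R f x \<partial>?M)
        = (\<integral>x. deriv \<psi> x *\<^sub>R f x \<partial>?M) - of_real c * (\<integral>x. deriv \<rho> x *\<^sub>R f x \<partial>?M)"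
      by (simp del: diff_eq_eq eq_diff_eq add: scaleR_conv_of_real algebra_simps)
  qed (use zero in auto)
  have "\<exists>c. AE x in ?M. f x + C * of_real x = c"
  proof (rule du_Bois_Reymond[OF assms(1)])
    have lin: "integrable ?M (\<lambda>x. C * of_real x)"
      by (intro integrable_continuous_open_interval continuous_intros)
    show "integrable ?M (\<lambda>x. f x + C * of_real x)" using f lin by simp
    fix \<psi> assume \<psi>: "\<psi> \<in> test_functions {0<..<\<epsilon>}"
    have "(\<integral>x. deriv \<psi> x *\<^sub>R (f x + C * of_real x) \<partial>?M)
        = (\<integral>x. deriv \<psi> x *\<^sub>R f x \<partial>?M) + (\<integral>x. deriv \<psi> x *\<^sub>R (C * of_real x) \<partial>?M)"
      unfolding scaleR_add_right
      by (intro Bochner_Integration.integral_add int[OF deriv_test[OF \<psi>]]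
          integrable_continuous_scaleR[OF cont[OF deriv_test[OF \<psi>]] lin])
    also have "(\<integral>x. deriv \<psi> x *\<^sub>R (C * of_real x) \<partial>?M) = - (\<integral>x. \<psi> x *\<^sub>R C \<partial>?M)"
      by (intro integral_by_parts_test_function \<psi> assms(1))
         (auto intro!: derivative_eq_intros simp: has_vector_derivative_def scaleR_conv_of_real mult.commute)
    finally show "(\<integral>x. deriv \<psi> x *\<^sub>R (f x + C * of_real x) \<partial>?M) = 0"
      using C[OF \<psi>] integral_of_real_test_function[OF \<psi>] by simp
  qed
  then obtain c where "AE x in ?M. f x + C * of_real x = c" by blast
  then have "AE x in ?M. f x = c + (- C) * of_real x" by eventually_elim (auto simp: algebra_simps)
  then show ?thesis by blast
qed

section \<open>Volterra operators\<close>

text \<open>Convolution over (0, x), written over the fixed interval with a cut-off so that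
  dominated convergence and Fubini's theorem work on one measure space.\<close>

definition volterra :: "real \<Rightarrow> (real \<Rightarrow> complex) \<Rightarrow> (real \<Rightarrow> complex) \<Rightarrow> real \<Rightarrow> complex" where
  "volterra \<epsilon> K h x = (\<integral>t. (if t < x then K (x - t) * h t else 0) \<partial>lebesgue_on {0<..<\<epsilon>})"

lemma measurable_ident_lebesgue_on: "(\<lambda>x. x) \<in> lebesgue_on S \<rightarrow>\<^sub>M borel"
  using id_borel_measurable_lebesgue_on[of S] by (simp add: id_def)

lemma volterra_integrand_measurable:
  fixes K h :: "real \<Rightarrow> complex"
  assumes "continuous_on UNIV K" "integrable (lebesgue_on {0<..<\<epsilon>}) h"
  shows "(\<lambda>t. if t < x then K (x - t) * h t else 0) \<in> borel_measurable (lebesgue_on {0<..<\<epsilon>})"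
proof -
  have "continuous_on {0..\<epsilon>} (\<lambda>t. K (x - t))"
    by (intro continuous_on_compose2[OF assms(1)] continuous_intros) auto
  then have "(\<lambda>t. K (x - t) * h t) \<in> borel_measurable (lebesgue_on {0<..<\<epsilon>})"
    by (rule borel_measurable_integrable[OF integrable_continuous_mult[OF _ assms(2)]])
  moreover have "indicat_real {..<x} \<in> borel_measurable (lebesgue_on {0<..<\<epsilon>})"
    by (rule measurable_compose[OF measurable_ident_lebesgue_on borel_measurable_indicator]) simp
  ultimately have "(\<lambda>t. indicat_real {..<x} t *\<^sub>R (K (x - t) * h t)) \<in> borel_measurable (lebesgue_on {0<..<\<epsilon>})"
    by simp
  moreover have "(\<lambda>t. indicat_real {..<x} t *\<^sub>R (K (x - t) * h t)) = (\<lambda>t. if t < x then K (x - t) * h t else 0)"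
    by (auto simp: indicator_def)
  ultimately show ?thesis by simp
qed

lemma volterra_kernel_bound:
  assumes "continuous_on UNIV (K :: real \<Rightarrow> complex)"
  obtains B where "0 < B" "\<And>x t. x \<in> {0..\<epsilon>} \<Longrightarrow> t \<in> {0<..<\<epsilon>} \<Longrightarrow> cmod (K (x - t)) \<le> B"
proof -
  have "bounded (K ` {- \<epsilon>..\<epsilon>})"
    by (intro compact_imp_bounded compact_continuous_image continuous_on_subset[OF assms]) auto
  then obtain B where "0 < B" "\<And>y. y \<in> {- \<epsilon>..\<epsilon>} \<Longrightarrow> cmod (K y) \<le> B"
    unfolding bounded_pos by (metis imageI)
  then show thesis by (intro that[of B]) auto
qed

text \<open>\<open>B\<close> bounds K on [- \<epsilon>, \<epsilon>], hence depends neither on h nor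
  on x. This uniformity is what later makes the resolvent bounded.\<close>

lemma volterra_bound:
  assumes "continuous_on UNIV K"
  obtains B where "0 < B" "\<And>h x. integrable (lebesgue_on {0<..<\<epsilon>}) h \<Longrightarrow> x \<in> {0..\<epsilon>} \<Longrightarrow>
      cmod (volterra \<epsilon> K h x) \<le> B * (\<integral>t. cmod (h t) \<partial>lebesgue_on {0<..<\<epsilon>})"
proof -
  obtain B where B: "0 < B" "\<And>x t. x \<in> {0..\<epsilon>} \<Longrightarrow> t \<in> {0<..<\<epsilon>} \<Longrightarrow> cmod (K (x - t)) \<le> B"
    using volterra_kernel_bound[OF assms] by metis
  show thesis
  proof (rule that[OF B(1)])
    fix h :: "real \<Rightarrow> complex" and x assume h: "integrable (lebesgue_on {0<..<\<epsilon>}) h" and x: "x \<in> {0..\<epsilon>}"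
    let ?k = "\<lambda>t. if t < x then K (x - t) * h t else 0"
    have le: "cmod (?k t) \<le> B * cmod (h t)" if "t \<in> {0<..<\<epsilon>}" for t
      using B(2)[OF x that] B(1) by (auto simp: norm_mult intro: mult_right_mono)
    have "integrable (lebesgue_on {0<..<\<epsilon>}) (\<lambda>t. B * cmod (h t))" using h by simp
    then have "integrable (lebesgue_on {0<..<\<epsilon>}) ?k"
    proof (rule Bochner_Integration.integrable_bound[OF _ volterra_integrand_measurable[OF assms h]])
      show "AE t in lebesgue_on {0<..<\<epsilon>}. norm (?k t) \<le> norm (B * cmod (h t))"
        using B(1) by (intro AE_I2 order_trans[OF le]) auto
    qed
    then have "cmod (volterra \<epsilon> K h x) \<le> (\<integral>t. B * cmod (h t) \<partial>lebesgue_on {0<..<\<epsilon>})"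
      unfolding volterra_def using h le
      by (intro order_trans[OF integral_norm_bound] integral_mono) auto
    then show "cmod (volterra \<epsilon> K h x) \<le> B * (\<integral>t. cmod (h t) \<partial>lebesgue_on {0<..<\<epsilon>})" by simp
  qed
qed

lemma volterra_AE_zero:
  assumes "continuous_on UNIV K" "integrable (lebesgue_on {0<..<\<epsilon>}) h"
    and "AE x in lebesgue_on {0<..<\<epsilon>}. h x = 0" "x \<in> {0..\<epsilon>}"
  shows "volterra \<epsilon> K h x = 0"
proof -
  have "(\<integral>t. cmod (h t) \<partial>lebesgue_on {0<..<\<epsilon>}) = 0"
    using assms(3) by (intro integral_eq_zero_AE) auto
  then show ?thesis using volterra_bound[OF assms(1)] assms(2,4) by (metis mult_zero_right norm_le_zero_iff)
qed

lemma volterra_cong_AE: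
  assumes "continuous_on UNIV K"
    and "integrable (lebesgue_on {0<..<\<epsilon>}) g" "integrable (lebesgue_on {0<..<\<epsilon>}) h"
    and "AE x in lebesgue_on {0<..<\<epsilon>}. g x = h x"
  shows "volterra \<epsilon> K g x = volterra \<epsilon> K h x"
  unfolding volterra_def using assms
  by (intro integral_cong_AE volterra_integrand_measurable) (auto elim!: eventually_mono)

lemma AE_lebesgue_on_neq: "S \<in> sets lebesgue \<Longrightarrow> AE t in lebesgue_on S. t \<noteq> (c::real)"
  using AE_completion[OF AE_lborel_singleton[of c]] by (auto simp: AE_restrict_space_iff elim!: eventually_mono)

text \<open>Although h is only integrable, the integrand depends continuously on x except for the
  jump of the cut-off at t = x, a single point; dominated convergence along sequences does the
  rest.\<close>

lemma continuous_on_volterra: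
  assumes K: "continuous_on UNIV K" and h: "integrable (lebesgue_on {0<..<\<epsilon>}) h"
  shows "continuous_on {0..\<epsilon>} (volterra \<epsilon> K h)"
  unfolding continuous_on_sequentially o_def
proof (intro allI ballI impI, elim conjE)
  fix s x assume x: "x \<in> {0..\<epsilon>}" and s: "\<forall>n. s n \<in> {0..\<epsilon>}" "s \<longlonglongrightarrow> x"
  obtain B where B: "0 < B" "\<And>x t. x \<in> {0..\<epsilon>} \<Longrightarrow> t \<in> {0<..<\<epsilon>} \<Longrightarrow> cmod (K (x - t)) \<le> B"
    using volterra_kernel_bound[OF K] by metis
  show "(\<lambda>n. volterra \<epsilon> K h (s n)) \<longlonglongrightarrow> volterra \<epsilon> K h x"
    unfolding volterra_def
  proof (rule integral_dominated_convergence[where w = "\<lambda>t. B * cmod (h t)"])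
    show "AE t in lebesgue_on {0<..<\<epsilon>}. (\<lambda>n. if t < s n then K (s n - t) * h t else 0)
        \<longlonglongrightarrow> (if t < x then K (x - t) * h t else 0)"
      using AE_lebesgue_on_neq[of "{0<..<\<epsilon>}" x, OF fmeasurableD[OF lmeasurable_interval(2)]]
    proof eventually_elim
      case (elim t)
      show ?case
      proof (cases "t < x")
        case True
        have "isCont K (x - t)" using K by (simp add: continuous_on_eq_continuous_at)
        then have "(\<lambda>n. K (s n - t)) \<longlonglongrightarrow> K (x - t)"
          by (rule isCont_tendsto_compose) (intro tendsto_intros s)
        then have "(\<lambda>n. K (s n - t) * h t) \<longlonglongrightarrow> K (x - t) * h t" by (intro tendsto_intros)
        moreover have "\<forall>\<^sub>F n in sequentially. K (s n - t) * h t = (if t < s n then K (s n - t) * h t else 0)"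
          using order_tendstoD(1)[OF s(2) True] by eventually_elim simp
        ultimately show ?thesis using True by (simp add: tendsto_cong)
      next
        case False
        then have "x < t" using elim by simp
        then have "\<forall>\<^sub>F n in sequentially. (if t < s n then K (s n - t) * h t else 0) = 0"
          using order_tendstoD(2)[OF s(2), of t] by (auto elim!: eventually_mono)
        then show ?thesis using False by (simp add: tendsto_eventually)
      qed
    qed
    show "AE t in lebesgue_on {0<..<\<epsilon>}. norm (if t < s n then K (s n - t) * h t else 0) \<le> B * cmod (h t)" for n
      using B(2)[of "s n"] B(1) s(1) by (intro AE_I2) (auto simp: norm_mult intro: mult_right_mono)
  qed (use h volterra_integrand_measurable[OF K h] in auto)
qed

text \<open>Fubini's theorem for g(x) K(x - t) h(t) on t < x, which is integrable over the square
  because it is dominated by a constant times |h(t)| and the interval has finite measure. Everything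
  that depends on x ends up in \<open>k\<close>, where no h stands in the way of
  differentiation.\<close>

lemma volterra_adjoint:
  fixes g :: "real \<Rightarrow> real"
  assumes g: "continuous_on UNIV g" and K: "continuous_on UNIV K"
    and h: "integrable (lebesgue_on {0<..<\<epsilon>}) h"
  defines "k \<equiv> \<lambda>t. \<integral>x. (if t < x then g x *\<^sub>R K (x - t) else 0) \<partial>lebesgue_on {0<..<\<epsilon>}"
  shows "(\<integral>x. g x *\<^sub>R volterra \<epsilon> K h x \<partial>lebesgue_on {0<..<\<epsilon>}) = (\<integral>t. k t * h t \<partial>lebesgue_on {0<..<\<epsilon>})"
    and "integrable (lebesgue_on {0<..<\<epsilon>}) (\<lambda>t. k t * h t)"
proof -
  let ?M = "lebesgue_on {0<..<\<epsilon>}"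
  interpret finite_measure ?M by (rule finite_measure_open_interval)
  interpret pair_sigma_finite ?M ?M by unfold_locales
  note id = measurable_ident_lebesgue_on[of "{0<..<\<epsilon>}"]
  define F where "F x t = (if t < x then g x *\<^sub>R K (x - t) else 0) * h t" for x t
  obtain B where B: "0 < B" "\<And>x t. x \<in> {0..\<epsilon>} \<Longrightarrow> t \<in> {0<..<\<epsilon>} \<Longrightarrow> cmod (K (x - t)) \<le> B"
    using volterra_kernel_bound[OF K] by metis
  have "bounded (g ` {0..\<epsilon>})"
    by (intro compact_imp_bounded compact_continuous_image continuous_on_subset[OF g]) auto
  then obtain G where G: "0 < G" "\<And>x. x \<in> {0..\<epsilon>} \<Longrightarrow> \<bar>g x\<bar> \<le> G"
    unfolding bounded_pos by (metis imageI real_norm_def)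
  have fst: "fst \<in> ?M \<Otimes>\<^sub>M ?M \<rightarrow>\<^sub>M borel" and snd: "snd \<in> ?M \<Otimes>\<^sub>M ?M \<rightarrow>\<^sub>M borel"
    using measurable_compose[OF measurable_fst id] measurable_compose[OF measurable_snd id] by auto
  have [measurable]: "(\<lambda>p. g (fst p)) \<in> borel_measurable (?M \<Otimes>\<^sub>M ?M)"
    by (rule measurable_compose[OF fst borel_measurable_continuous_onI[OF g]])
  have [measurable]: "(\<lambda>p. K (fst p - snd p)) \<in> borel_measurable (?M \<Otimes>\<^sub>M ?M)"
    by (rule measurable_compose[OF borel_measurable_diff[OF fst snd] borel_measurable_continuous_onI[OF K]])
  have [measurable]: "(\<lambda>p. h (snd p)) \<in> borel_measurable (?M \<Otimes>\<^sub>M ?M)"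
    by (rule measurable_compose[OF measurable_snd borel_measurable_integrable[OF h]])
  have [measurable]: "Measurable.pred (?M \<Otimes>\<^sub>M ?M) (\<lambda>p. snd p < fst p)"
    using borel_measurable_less[OF snd fst] by (simp add: pred_def)
  have hprod: "integrable (?M \<Otimes>\<^sub>M ?M) (\<lambda>p. of_real (G * B) * h (snd p))"
    by (intro integrable_mult_right Fubini_integrable) (use h in auto)
  have "integrable (?M \<Otimes>\<^sub>M ?M) (\<lambda>p. F (fst p) (snd p))"
  proof (rule Bochner_Integration.integrable_bound[OF hprod])
    show "(\<lambda>p. F (fst p) (snd p)) \<in> borel_measurable (?M \<Otimes>\<^sub>M ?M)"
      unfolding F_def by measurable
    show "AE p in ?M \<Otimes>\<^sub>M ?M. norm (F (fst p) (snd p)) \<le> norm (of_real (G * B) * h (snd p))"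
    proof (rule AE_I2)
      fix p assume "p \<in> space (?M \<Otimes>\<^sub>M ?M)"
      then have "fst p \<in> {0<..<\<epsilon>}" "snd p \<in> {0<..<\<epsilon>}" by (auto simp: space_pair_measure)
      then have "\<bar>g (fst p)\<bar> * cmod (K (fst p - snd p)) \<le> G * B"
        using G B by (intro mult_mono) auto
      then show "norm (F (fst p) (snd p)) \<le> norm (of_real (G * B) * h (snd p))"
        using G B by (auto simp: F_def norm_mult intro!: mult_right_mono)
    qed
  qed
  then have F: "integrable (?M \<Otimes>\<^sub>M ?M) (\<lambda>(x, t). F x t)" by (simp add: case_prod_unfold)
  have k: "(\<integral>x. F x t \<partial>?M) = k t * h t" for t
    by (simp add: F_def k_def)
  have "(\<integral>t. F x t \<partial>?M) = g x *\<^sub>R volterra \<epsilon> K h x" for x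
    unfolding volterra_def integral_scaleR_right[symmetric] F_def
    by (intro Bochner_Integration.integral_cong) auto
  then show "(\<integral>x. g x *\<^sub>R volterra \<epsilon> K h x \<partial>?M) = (\<integral>t. k t * h t \<partial>?M)"
    using Fubini_integral[OF F] k by simp
  show "integrable ?M (\<lambda>t. k t * h t)"
    using integrable_snd[OF F] k by simp
qed

text \<open>Leibniz's rule for convolutions, in weak form since h need not be continuous. After
  passing to the adjoints, the two kernels combine to the integral over (t, \<epsilon>) of the
  x-derivative of \<phi>(x) K(x - t). The upper limit contributes nothing, as \<phi> vanishes there;
  the lower one leaves - \<phi>(t) K(0), the source of the term \<open>K 0 * h x\<close>.\<close>

lemma volterra_weak_derivative:
  assumes "0 < \<epsilon>" and K: "\<And>x. (K has_vector_derivative K' x) (at x)" "continuous_on UNIV K'"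
    and h: "integrable (lebesgue_on {0<..<\<epsilon>}) h"
  shows "has_weak_derivative {0<..<\<epsilon>} 1 (volterra \<epsilon> K h) (\<lambda>x. volterra \<epsilon> K' h x + K 0 * h x)"
  unfolding has_weak_derivative_def
proof
  fix \<phi> assume \<phi>: "\<phi> \<in> test_functions {0<..<\<epsilon>}"
  let ?M = "lebesgue_on {0<..<\<epsilon>}"
  note d\<phi> = deriv_test_function[OF \<phi> assms(1)]
  note c = continuous_on_test_function[OF \<phi>] continuous_on_test_function[OF d\<phi>]
  have cK: "continuous_on UNIV K"
    using K(1) by (meson continuous_at_imp_continuous_on has_vector_derivative_continuous)
  define k where "k t = (\<integral>x. (if t < x then deriv \<phi> x *\<^sub>R K (x - t) else 0) \<partial>?M)" for t
  define k' where "k' t = (\<integral>x. (if t < x then \<phi> x *\<^sub>R K' (x - t) else 0) \<partial>?M)" for t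
  have shift: "continuous_on A (\<lambda>x. K (x - t))" "continuous_on A (\<lambda>x. K' (x - t))" for t A
    by (intro continuous_on_compose2[OF cK] continuous_on_compose2[OF K(2)] continuous_intros; simp)+
  have kk': "k t + k' t = - (\<phi> t *\<^sub>R K 0)" if "t \<in> {0<..<\<epsilon>}" for t
  proof -
    have restrict: "integrable ?M (\<lambda>x. if t < x then f x else 0)" if "continuous_on UNIV f" for f :: "real \<Rightarrow> complex"
    proof -
      have "integrable ?M (\<lambda>x. f x)"
        by (intro integrable_continuous_open_interval continuous_on_subset[OF that]) auto
      then have "integrable ?M (\<lambda>x. indicat_real ({t<..} \<inter> {0<..<\<epsilon>}) x *\<^sub>R f x)"
        by (rule integrable_mult_indicator[rotated]) (auto simp: sets_restrict_space)
      then show ?thesis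
        by (rule Bochner_Integration.integrable_cong[THEN iffD1, rotated 2]) (auto simp: indicator_def)
    qed
    have "k t + k' t = (\<integral>x. (if t < x then deriv \<phi> x *\<^sub>R K (x - t) else 0)
        + (if t < x then \<phi> x *\<^sub>R K' (x - t) else 0) \<partial>?M)"
      unfolding k_def k'_def
      by (intro Bochner_Integration.integral_add[symmetric] restrict continuous_intros c shift)
    also have "\<dots> = (\<integral>x. (if t < x then deriv \<phi> x *\<^sub>R K (x - t) + \<phi> x *\<^sub>R K' (x - t) else 0) \<partial>?M)"
      by (intro Bochner_Integration.integral_cong) auto
    also have "\<dots> = \<phi> \<epsilon> *\<^sub>R K (\<epsilon> - t) - \<phi> t *\<^sub>R K (t - t)"
    proof (rule integral_greaterThan_FTC)
      fix x
      have "((\<lambda>x. x - t) has_vector_derivative 1) (at x)"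
        by (auto intro!: derivative_eq_intros)
      from vector_diff_chain_at[OF this K(1)[of "x - t"]]
      have "((\<lambda>x. K (x - t)) has_vector_derivative K' (x - t)) (at x)" by (simp add: o_def)
      then show "((\<lambda>x. \<phi> x *\<^sub>R K (x - t)) has_vector_derivative
          deriv \<phi> x *\<^sub>R K (x - t) + \<phi> x *\<^sub>R K' (x - t)) (at x)"
        by (rule has_vector_derivative_test_function_scaleR[OF \<phi>])
    qed (use that in \<open>auto intro!: continuous_intros c shift\<close>)
    finally show ?thesis using test_function_boundary[OF \<phi> assms(1)] by simp
  qed
  note adj = volterra_adjoint[OF c(2) cK h, folded k_def] volterra_adjoint[OF c(1) K(2) h, folded k'_def]
  have "(\<integral>x. deriv \<phi> x *\<^sub>R volterra \<epsilon> K h x \<partial>?M) + (\<integral>x. \<phi> x *\<^sub>R volterra \<epsilon> K' h x \<partial>?M)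
      = (\<integral>t. k t * h t + k' t * h t \<partial>?M)"
    unfolding adj(1,3) by (intro Bochner_Integration.integral_add[symmetric] adj)
  also have "\<dots> = (\<integral>t. - (\<phi> t *\<^sub>R (K 0 * h t)) \<partial>?M)"
    using kk' by (intro Bochner_Integration.integral_cong) (auto simp: distrib_right[symmetric])
  also have "\<dots> = - (\<integral>t. \<phi> t *\<^sub>R (K 0 * h t) \<partial>?M)" by simp
  finally have 1: "(\<integral>x. deriv \<phi> x *\<^sub>R volterra \<epsilon> K h x \<partial>?M)
      = - ((\<integral>x. \<phi> x *\<^sub>R volterra \<epsilon> K' h x \<partial>?M) + (\<integral>t. \<phi> t *\<^sub>R (K 0 * h t) \<partial>?M))"
    by (simp add: algebra_simps eq_neg_iff_add_eq_0)
  have "(\<integral>x. \<phi> x *\<^sub>R volterra \<epsilon> K' h x \<partial>?M) + (\<integral>t. \<phi> t *\<^sub>R (K 0 * h t) \<partial>?M)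
      = (\<integral>x. \<phi> x *\<^sub>R (volterra \<epsilon> K' h x + K 0 * h x) \<partial>?M)"
    unfolding scaleR_add_right
    by (intro Bochner_Integration.integral_add[symmetric] integrable_continuous_scaleR c
        integrable_mult_right h integrable_continuous_open_interval continuous_on_volterra K(2))
  with 1 show "(\<integral>x. (deriv ^^ 1) \<phi> x *\<^sub>R volterra \<epsilon> K h x \<partial>?M) =
      (- 1) ^ 1 * (\<integral>x. \<phi> x *\<^sub>R (volterra \<epsilon> K' h x + K 0 * h x) \<partial>?M)"
    by simp
qed

section \<open>Weak derivatives\<close>

lemma continuous_on_deriv_funpow_test_function:
  assumes "\<phi> \<in> test_functions S"
  shows "continuous_on A ((deriv ^^ k) \<phi>)"
proof (rule continuous_at_imp_continuous_on, rule ballI)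
  fix x
  have "(deriv ^^ k) \<phi> field_differentiable (at x)"
    using assms unfolding test_functions_def by blast
  then show "isCont ((deriv ^^ k) \<phi>) x" by (rule field_differentiable_imp_continuous_at)
qed

lemma has_weak_derivative_diff:
  assumes "has_weak_derivative {a<..<b} k f f'" "has_weak_derivative {a<..<b} k g g'"
    and "integrable (lebesgue_on {a<..<b}) f" "integrable (lebesgue_on {a<..<b}) f'"
    and "integrable (lebesgue_on {a<..<b}) g" "integrable (lebesgue_on {a<..<b}) g'"
  shows "has_weak_derivative {a<..<b} k (\<lambda>x. f x - g x) (\<lambda>x. f' x - g' x)"
  unfolding has_weak_derivative_def
proof
  fix \<phi> assume \<phi>: "\<phi> \<in> test_functions {a<..<b}"
  note int = integrable_continuous_scaleR[OF continuous_on_deriv_funpow_test_function[OF \<phi>]]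
    integrable_continuous_scaleR[OF continuous_on_test_function[OF \<phi>]]
  show "(\<integral>x. (deriv ^^ k) \<phi> x *\<^sub>R (f x - g x) \<partial>lebesgue_on {a<..<b})
      = (- 1) ^ k * (\<integral>x. \<phi> x *\<^sub>R (f' x - g' x) \<partial>lebesgue_on {a<..<b})"
    using assms(1,2) \<phi> unfolding has_weak_derivative_def
    by (simp add: scaleR_diff_right Bochner_Integration.integral_diff int assms(3-) right_diff_distrib)
qed

lemma has_weak_derivative_cmult:
  assumes "has_weak_derivative S k f f'"
  shows "has_weak_derivative S k (\<lambda>x. c * f x) (\<lambda>x. c * f' x)"
  using assms unfolding has_weak_derivative_def
  by (simp add: mult_scaleR_right[symmetric] del: mult_scaleR_right)

lemma has_weak_derivative_cong_AE:
  assumes "has_weak_derivative {a<..<b} k f g" "AE x in lebesgue_on {a<..<b}. f x = f' x"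
    "AE x in lebesgue_on {a<..<b}. g x = g' x"
    and "integrable (lebesgue_on {a<..<b}) f" "integrable (lebesgue_on {a<..<b}) f'"
    and "integrable (lebesgue_on {a<..<b}) g" "integrable (lebesgue_on {a<..<b}) g'"
  shows "has_weak_derivative {a<..<b} k f' g'"
  unfolding has_weak_derivative_def
proof
  fix \<phi> assume \<phi>: "\<phi> \<in> test_functions {a<..<b}"
  note int = borel_measurable_integrable[OF integrable_continuous_scaleR[OF continuous_on_deriv_funpow_test_function[OF \<phi>]]]
    borel_measurable_integrable[OF integrable_continuous_scaleR[OF continuous_on_test_function[OF \<phi>]]]
  have "(\<integral>x. (deriv ^^ k) \<phi> x *\<^sub>R f x \<partial>lebesgue_on {a<..<b}) = (\<integral>x. (deriv ^^ k) \<phi> x *\<^sub>R f' x \<partial>lebesgue_on {a<..<b})"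
    using assms(2) by (intro integral_cong_AE int assms) (auto elim!: eventually_mono)
  moreover have "(\<integral>x. \<phi> x *\<^sub>R g x \<partial>lebesgue_on {a<..<b}) = (\<integral>x. \<phi> x *\<^sub>R g' x \<partial>lebesgue_on {a<..<b})"
    using assms(3) by (intro integral_cong_AE int assms) (auto elim!: eventually_mono)
  ultimately show "(\<integral>x. (deriv ^^ k) \<phi> x *\<^sub>R f' x \<partial>lebesgue_on {a<..<b})
      = (- 1) ^ k * (\<integral>x. \<phi> x *\<^sub>R g' x \<partial>lebesgue_on {a<..<b})"
    using assms(1) \<phi> unfolding has_weak_derivative_def by simp
qed

lemma has_weak_derivative_twice:
  assumes "0 < \<epsilon>" "has_weak_derivative {0<..<\<epsilon>} 1 f g" "has_weak_derivative {0<..<\<epsilon>} 1 g h"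
  shows "has_weak_derivative {0<..<\<epsilon>} 2 f h"
  using assms deriv_test_function[OF _ assms(1)]
  unfolding has_weak_derivative_def by (auto simp: numeral_2_eq_2)

lemma has_weak_derivative_classical:
  fixes K K' :: "real \<Rightarrow> complex"
  assumes "0 < \<epsilon>" "\<And>x. (K has_vector_derivative K' x) (at x)" "continuous_on UNIV K'"
  shows "has_weak_derivative {0<..<\<epsilon>} 1 K K'"
  using integral_by_parts_test_function[OF _ assms] unfolding has_weak_derivative_def by simp

lemma has_weak_derivative_unique:
  assumes "0 < \<epsilon>" "has_weak_derivative {0<..<\<epsilon>} k f g" "has_weak_derivative {0<..<\<epsilon>} k f h"
    and g: "integrable (lebesgue_on {0<..<\<epsilon>}) g" and h: "integrable (lebesgue_on {0<..<\<epsilon>}) h"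
  shows "AE x in lebesgue_on {0<..<\<epsilon>}. g x = h x"
proof -
  have "AE x in lebesgue_on {0<..<\<epsilon>}. g x - h x = 0"
  proof (rule fundamental_lemma[OF _ _ assms(1)])
    show "integrable (lebesgue_on {0<..<\<epsilon>}) (\<lambda>x. g x - h x)" using g h by simp
    fix \<phi> assume \<phi>: "\<phi> \<in> test_functions {0<..<\<epsilon>}"
    have "(- 1) ^ k * (\<integral>x. \<phi> x *\<^sub>R g x \<partial>lebesgue_on {0<..<\<epsilon>})
        = (- 1) ^ k * (\<integral>x. \<phi> x *\<^sub>R h x \<partial>lebesgue_on {0<..<\<epsilon>})"
      using bspec[OF assms(2)[unfolded has_weak_derivative_def] \<phi>]
        bspec[OF assms(3)[unfolded has_weak_derivative_def] \<phi>] by (rule trans[OF sym])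
    then have "(\<integral>x. \<phi> x *\<^sub>R g x \<partial>lebesgue_on {0<..<\<epsilon>}) = (\<integral>x. \<phi> x *\<^sub>R h x \<partial>lebesgue_on {0<..<\<epsilon>})"
      by simp
    then show "(\<integral>x. \<phi> x *\<^sub>R (g x - h x) \<partial>lebesgue_on {0<..<\<epsilon>}) = 0"
      by (simp add: scaleR_diff_right Bochner_Integration.integral_diff g h
          integrable_continuous_scaleR[OF continuous_on_test_function[OF \<phi>]])
  qed
  then show ?thesis by simp
qed

text \<open>The set of disagreement in the open interval is open and null, hence empty; the
  endpoints follow by continuity. This is how almost-everywhere statements reach the boundary
  values.\<close>

lemma continuous_on_AE_eq:
  fixes u v :: "real \<Rightarrow> complex"
  assumes "continuous_on {a..b} u" "continuous_on {a..b} v" "a < b"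
    and "AE x in lebesgue_on {a<..<b}. u x = v x" "x \<in> {a..b}"
  shows "u x = v x"
proof -
  have c: "continuous_on (closure {a<..<b}) (\<lambda>x. u x - v x)"
    using assms by (simp add: continuous_on_diff)
  let ?U = "{x \<in> {a<..<b}. u x - v x \<noteq> 0}"
  have "open ?U"
  proof -
    have "?U = {a<..<b} \<inter> (\<lambda>x. u x - v x) -` (- {0})" by auto
    then show ?thesis
      using continuous_open_preimage[OF continuous_on_subset[OF c closure_subset] open_greaterThanLessThan, of "- {0}"]
      by (simp add: open_Compl)
  qed
  moreover have "negligible ?U"
  proof -
    have "AE x in lebesgue. x \<notin> ?U"
      using assms(4) by (auto simp: AE_restrict_space_iff elim!: eventually_mono)
    moreover have "?U \<in> sets lebesgue" using \<open>open ?U\<close> by (simp add: lebesgue_openin)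
    ultimately show ?thesis
      by (auto simp: negligible_iff_null_sets AE_iff_null_sets)
  qed
  ultimately have "?U = {}" using open_not_negligible by blast
  then have "u x - v x = 0"
    using continuous_constant_on_closure[OF c, of 0 x] assms(3,5) by auto
  then show ?thesis by simp
qed

section \<open>The equation \<open>u'' = - z u\<close>\<close>

definition ode_cos :: "complex \<Rightarrow> real \<Rightarrow> complex" where
  "ode_cos z x = cos (csqrt z * of_real x)"

text \<open>Like \<open>ode_cos\<close>, it is even in the square root, so the branch is immaterial.
  At z = 0 the quotient would be 0 by the convention for division, so its limit x is put in.\<close>

definition ode_sin :: "complex \<Rightarrow> real \<Rightarrow> complex" where
  "ode_sin z x = (if z = 0 then of_real x else sin (csqrt z * of_real x) / csqrt z)"

lemma ode_cos_0 [simp]: "ode_cos z 0 = 1" and ode_sin_0 [simp]: "ode_sin z 0 = 0"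
  by (simp_all add: ode_cos_def ode_sin_def)

text \<open>This is the Wronskian C S' - C' S, the determinant of the linear system solved in
  \<open>ode_unique\<close>.\<close>

lemma ode_cos_sin_pythagoras: "(ode_cos z x)\<^sup>2 + z * (ode_sin z x)\<^sup>2 = 1"
proof -
  have "z * (ode_sin z x)\<^sup>2 = (sin (csqrt z * of_real x))\<^sup>2"
    by (cases "z = 0") (simp_all add: ode_sin_def power_divide)
  then show ?thesis by (simp add: ode_cos_def)
qed

lemma has_vector_derivative_ode_sin: "(ode_sin z has_vector_derivative ode_cos z x) (at x within A)"
proof (cases "z = 0")
  case True
  have "ode_sin z = of_real" "ode_cos z x = 1" using True by (auto simp: ode_sin_def ode_cos_def)
  then show ?thesis by (auto intro!: derivative_eq_intros simp: has_vector_derivative_def scaleR_conv_of_real)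
next
  case False
  have "((\<lambda>w. sin (csqrt z * w) / csqrt z) has_field_derivative cos (csqrt z * of_real x)) (at (of_real x))"
    using False by (auto intro!: derivative_eq_intros)
  then show ?thesis
    using False has_vector_derivative_real_field[of "\<lambda>w. sin (csqrt z * w) / csqrt z" _ x A]
    by (simp add: ode_sin_def[abs_def] ode_cos_def)
qed

lemma has_vector_derivative_ode_cos: "(ode_cos z has_vector_derivative - z * ode_sin z x) (at x within A)"
proof -
  have "((\<lambda>w. cos (csqrt z * w)) has_field_derivative - (csqrt z * sin (csqrt z * of_real x))) (at (of_real x))"
    by (auto intro!: derivative_eq_intros)
  moreover have "csqrt z * sin (csqrt z * of_real x) = z * ode_sin z x"
    using power2_csqrt[of z] by (cases "z = 0") (auto simp: ode_sin_def power2_eq_square field_simps)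
  ultimately show ?thesis
    using has_vector_derivative_real_field[of "\<lambda>w. cos (csqrt z * w)" _ x A]
    by (simp add: ode_cos_def[abs_def])
qed

lemma continuous_on_ode_cos [continuous_intros]: "continuous_on A (ode_cos z)"
  and continuous_on_ode_sin [continuous_intros]: "continuous_on A (ode_sin z)"
  by (auto intro!: continuous_on_vector_derivative has_vector_derivative_ode_cos has_vector_derivative_ode_sin)

text \<open>Cramer's rule: \<open>A\<close> and \<open>B\<close> solve u = A C + B S and w = - z A S
  + B C, a system of determinant 1, and the differential equations make both constant.\<close>

lemma ode_unique:
  assumes "\<And>x. x \<in> {0..\<epsilon>} \<Longrightarrow> (u has_vector_derivative w x) (at x within {0..\<epsilon>})"
    and "\<And>x. x \<in> {0..\<epsilon>} \<Longrightarrow> (w has_vector_derivative - z * u x) (at x within {0..\<epsilon>})"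
    and "x \<in> {0..\<epsilon>}"
  shows "u x = u 0 * ode_cos z x + w 0 * ode_sin z x"
proof -
  define A where "A x = u x * ode_cos z x - w x * ode_sin z x" for x
  define B where "B x = z * (u x * ode_sin z x) + w x * ode_cos z x" for x
  have "(A has_vector_derivative 0) (at y within {0..\<epsilon>})" if "y \<in> {0..\<epsilon>}" for y
    unfolding A_def using assms(1,2)[OF that]
    by (auto intro!: derivative_eq_intros has_vector_derivative_ode_cos has_vector_derivative_ode_sin simp: algebra_simps)
  then obtain a where a: "\<And>y. y \<in> {0..\<epsilon>} \<Longrightarrow> A y = a"
    using has_derivative_zero_constant[of "{0..\<epsilon>}" A] by (auto simp: has_vector_derivative_def)
  have "(B has_vector_derivative 0) (at y within {0..\<epsilon>})" if "y \<in> {0..\<epsilon>}" for y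
    unfolding B_def using assms(1,2)[OF that]
    by (auto intro!: derivative_eq_intros has_vector_derivative_ode_cos has_vector_derivative_ode_sin simp: algebra_simps)
  then obtain b where b: "\<And>y. y \<in> {0..\<epsilon>} \<Longrightarrow> B y = b"
    using has_derivative_zero_constant[of "{0..\<epsilon>}" B] by (auto simp: has_vector_derivative_def)
  have "u x = u x * ((ode_cos z x)\<^sup>2 + z * (ode_sin z x)\<^sup>2)"
    by (simp add: ode_cos_sin_pythagoras)
  also have "\<dots> = A x * ode_cos z x + B x * ode_sin z x"
    by (simp add: A_def B_def algebra_simps power2_eq_square)
  also have "A x = A 0" using a[of 0] a[OF assms(3)] assms(3) by simp
  also have "B x = B 0" using b[of 0] b[OF assms(3)] assms(3) by simp
  finally show ?thesis by (simp add: A_def B_def)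
qed

lemma volterra_ode_cos_weak_derivative:
  assumes "0 < \<epsilon>" "integrable (lebesgue_on {0<..<\<epsilon>}) h"
  shows "has_weak_derivative {0<..<\<epsilon>} 1 (volterra \<epsilon> (ode_cos z) h)
           (\<lambda>x. h x - z * volterra \<epsilon> (ode_sin z) h x)"
proof -
  have "volterra \<epsilon> (\<lambda>x. - z * ode_sin z x) h x = - z * volterra \<epsilon> (ode_sin z) h x" for x
    unfolding volterra_def integral_mult_right_zero[symmetric]
    by (intro Bochner_Integration.integral_cong) auto
  then show ?thesis
    using volterra_weak_derivative[OF assms(1) has_vector_derivative_ode_cos _ assms(2), of z]
    by (simp add: continuous_intros)
qed

lemma volterra_ode_sin_weak_derivative:
  assumes "0 < \<epsilon>" "integrable (lebesgue_on {0<..<\<epsilon>}) h"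
  shows "has_weak_derivative {0<..<\<epsilon>} 1 (volterra \<epsilon> (ode_sin z) h) (volterra \<epsilon> (ode_cos z) h)"
  using volterra_weak_derivative[OF assms(1) has_vector_derivative_ode_sin _ assms(2), of z]
  by (simp add: continuous_intros)

text \<open>For z = 0 the kernel is x - t. Splitting it takes x out of the integral and leaves
  primitives of continuous functions, which can be differentiated classically.\<close>

lemma volterra_ode_sin_0:
  assumes u: "continuous_on {0..\<epsilon>} u" and x: "x \<in> {0..\<epsilon>}"
  shows "volterra \<epsilon> (ode_sin 0) u x
    = of_real x * integral {0..x} u - integral {0..x} (\<lambda>t. of_real t * u t)"
proof -
  have ux: "continuous_on {0..x} u" using u x by (auto intro: continuous_on_subset)
  have "volterra \<epsilon> (ode_sin 0) u x = (\<integral>t. (if t \<in> {0<..<x} then of_real (x - t) * u t else 0) \<partial>lebesgue_on {0<..<\<epsilon>})"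
    unfolding volterra_def by (intro Bochner_Integration.integral_cong) (auto simp: ode_sin_def)
  also have "\<dots> = (\<integral>t. of_real (x - t) * u t \<partial>lebesgue_on {0<..<x})"
    using x by (intro integral_restrict) auto
  also have "\<dots> = integral {0..x} (\<lambda>t. of_real (x - t) * u t)"
    by (intro integral_continuous_open_interval continuous_intros ux)
  also have "\<dots> = integral {0..x} (\<lambda>t. of_real x * u t - of_real t * u t)"
    by (simp add: algebra_simps)
  also have "\<dots> = of_real x * integral {0..x} u - integral {0..x} (\<lambda>t. of_real t * u t)"
    by (subst Henstock_Kurzweil_Integration.integral_diff)
       (auto intro!: integrable_continuous_real continuous_intros ux)
  finally show ?thesis .
qed

text \<open>The fixed point equation exhibits \<open>u\<close> as a double primitive, hence as a classical solution of \<open>u'' = - z u\<close>.\<close>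

lemma volterra_fixed_point:
  assumes u: "continuous_on {0..\<epsilon>} u"
    and eq: "\<And>x. x \<in> {0..\<epsilon>} \<Longrightarrow> u x = c + d * of_real x - z * volterra \<epsilon> (ode_sin 0) u x"
    and x: "x \<in> {0..\<epsilon>}"
  shows "u x = c * ode_cos z x + d * ode_sin z x"
proof -
  define U where "U x = integral {0..x} u" for x
  define V where "V x = integral {0..x} (\<lambda>t. of_real t * u t)" for x
  have U: "(U has_vector_derivative u y) (at y within {0..\<epsilon>})" if "y \<in> {0..\<epsilon>}" for y
    unfolding U_def by (intro integral_has_vector_derivative u that)
  have V: "(V has_vector_derivative of_real y * u y) (at y within {0..\<epsilon>})" if "y \<in> {0..\<epsilon>}" for y
    unfolding V_def using that by (intro integral_has_vector_derivative continuous_intros u)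
  have I: "((of_real :: real \<Rightarrow> complex) has_vector_derivative 1) (at y within {0..\<epsilon>})" for y
    by (auto intro!: derivative_eq_intros simp: has_vector_derivative_def scaleR_conv_of_real)
  have u_eq: "u y = c + d * of_real y - z * (of_real y * U y - V y)" if "y \<in> {0..\<epsilon>}" for y
    using eq[OF that] volterra_ode_sin_0[OF u that] by (simp add: U_def V_def)
  \<comment> \<open>The derivative of x U - V is U, since the terms x u cancel; hence u' = d - z U,
    whose derivative is - z u and whose value at 0 is d.\<close>
  have "u x = u 0 * ode_cos z x + (d - z * U 0) * ode_sin z x"
  proof (rule ode_unique[OF _ _ x, where w = "\<lambda>y. d - z * U y"])
    fix y assume y: "y \<in> {0..\<epsilon>}"
    have "((\<lambda>y. c + d * of_real y - z * (of_real y * U y - V y)) has_vector_derivative d - z * U y) (at y within {0..\<epsilon>})"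
      using U[OF y] V[OF y] I[of y]
      by (auto intro!: derivative_eq_intros simp: algebra_simps)
    then show "(u has_vector_derivative d - z * U y) (at y within {0..\<epsilon>})"
      by (rule has_vector_derivative_transform[OF y, rotated]) (use u_eq in auto)
    show "((\<lambda>y. d - z * U y) has_vector_derivative - z * u y) (at y within {0..\<epsilon>})"
      using U[OF y] by (auto intro!: derivative_eq_intros)
  qed
  moreover have "U 0 = 0" "V 0 = 0" by (simp_all add: U_def V_def)
  moreover have "u 0 = c" using u_eq[of 0] x \<open>U 0 = 0\<close> \<open>V 0 = 0\<close> by auto
  ultimately show ?thesis by simp
qed

lemma weak_solution_variation_of_constants:
  assumes "0 < \<epsilon>" and f: "integrable (lebesgue_on {0<..<\<epsilon>}) f" and h: "integrable (lebesgue_on {0<..<\<epsilon>}) h"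
    and weak: "has_weak_derivative {0<..<\<epsilon>} 2 f (\<lambda>x. - (z * f x + h x))"
  shows "\<exists>c d. AE x in lebesgue_on {0<..<\<epsilon>}.
      f x = c * ode_cos z x + d * ode_sin z x - volterra \<epsilon> (ode_sin z) h x"
proof -
  let ?M = "lebesgue_on {0<..<\<epsilon>}"
  \<comment> \<open>The parameter \<open>w\<close> is separate from \<open>z\<close> because the
    rule is used with w = z on h and with w = 0 on p.\<close>
  have second: "has_weak_derivative {0<..<\<epsilon>} 2 (volterra \<epsilon> (ode_sin w) g) (\<lambda>x. g x - w * volterra \<epsilon> (ode_sin w) g x)"
    if "integrable ?M g" for w g
    by (rule has_weak_derivative_twice[OF assms(1) volterra_ode_sin_weak_derivative volterra_ode_cos_weak_derivative])
       (use assms(1) that in auto)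
  have int: "integrable ?M (volterra \<epsilon> (ode_sin w) g)" if "integrable ?M g" for w g
    by (intro integrable_continuous_open_interval continuous_on_volterra continuous_intros that)
  define p where "p x = f x + volterra \<epsilon> (ode_sin z) h x" for x
  have p: "integrable ?M p" unfolding p_def using f int[OF h] by simp
  have "has_weak_derivative {0<..<\<epsilon>} 2 (\<lambda>x. f x - (- 1) * volterra \<epsilon> (ode_sin z) h x)
      (\<lambda>x. - (z * f x + h x) - (- 1) * (h x - z * volterra \<epsilon> (ode_sin z) h x))"
    using f h int[OF h]
    by (intro has_weak_derivative_diff has_weak_derivative_cmult weak second) auto
  then have wp: "has_weak_derivative {0<..<\<epsilon>} 2 p (\<lambda>x. - z * p x)"
    by (simp add: p_def[abs_def] algebra_simps)
  have "has_weak_derivative {0<..<\<epsilon>} 2 (\<lambda>x. p x - (- z) * volterra \<epsilon> (ode_sin 0) p x)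
      (\<lambda>x. - z * p x - (- z) * (p x - 0 * volterra \<epsilon> (ode_sin 0) p x))"
    using p int[OF p]
    by (intro has_weak_derivative_diff has_weak_derivative_cmult wp second) auto
  then have wq: "has_weak_derivative {0<..<\<epsilon>} 2 (\<lambda>x. p x + z * volterra \<epsilon> (ode_sin 0) p x) (\<lambda>x. 0)"
    by simp
  have "\<exists>c d. AE x in ?M. p x + z * volterra \<epsilon> (ode_sin 0) p x = c + d * of_real x"
  proof (rule du_Bois_Reymond_second[OF assms(1)])
    show "integrable ?M (\<lambda>x. p x + z * volterra \<epsilon> (ode_sin 0) p x)"
      using p int[OF p] by simp
    show "(\<integral>x. deriv (deriv \<phi>) x *\<^sub>R (p x + z * volterra \<epsilon> (ode_sin 0) p x) \<partial>?M) = 0"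
      if "\<phi> \<in> test_functions {0<..<\<epsilon>}" for \<phi>
      using wq that unfolding has_weak_derivative_def by (auto simp: numeral_2_eq_2)
  qed
  then obtain c d where cd: "AE x in ?M. p x + z * volterra \<epsilon> (ode_sin 0) p x = c + d * of_real x" by blast
  \<comment> \<open>The affine relation solved for p: the right-hand side is continuous although p
    is merely integrable.\<close>
  define u where "u x = c + d * of_real x - z * volterra \<epsilon> (ode_sin 0) p x" for x
  have cu: "continuous_on {0..\<epsilon>} u"
    unfolding u_def by (intro continuous_intros continuous_on_volterra p)
  have pu: "AE x in ?M. p x = u x"
    using cd by eventually_elim (simp add: u_def algebra_simps eq_diff_eq)
  \<comment> \<open>Volterra operators do not distinguish p from u, so the integral equation for u
    holds at every point.\<close>
  have "volterra \<epsilon> (ode_sin 0) p x = volterra \<epsilon> (ode_sin 0) u x" for x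
    by (intro volterra_cong_AE continuous_intros p integrable_continuous_open_interval cu pu)
  then have "u x = c + d * of_real x - z * volterra \<epsilon> (ode_sin 0) u x" for x
    by (simp add: u_def)
  then have u_eq: "u x = c * ode_cos z x + d * ode_sin z x" if "x \<in> {0..\<epsilon>}" for x
    using volterra_fixed_point[OF cu _ that] by blast
  have "AE x in ?M. f x = c * ode_cos z x + d * ode_sin z x - volterra \<epsilon> (ode_sin z) h x"
    using pu AE_space
  proof eventually_elim
    case (elim x)
    then show ?case using u_eq[of x] by (simp add: p_def eq_diff_eq)
  qed
  then show ?thesis by blast
qed

section \<open>Square-integrable functions on an interval\<close>

lemma L2_continuous:
  fixes f :: "real \<Rightarrow> complex"
  assumes "continuous_on {a..b} f"
  shows "f \<in> L2 (lebesgue_on {a<..<b})"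
proof -
  \<comment> \<open>The square is cast to a complex number because the integrability lemma for
    continuous functions is stated for complex values.\<close>
  have "integrable (lebesgue_on {a<..<b}) (\<lambda>x. complex_of_real ((cmod (f x))\<^sup>2))"
    by (intro integrable_continuous_open_interval continuous_intros assms)
  then have "integrable (lebesgue_on {a<..<b}) (\<lambda>x. (cmod (f x))\<^sup>2)"
    using integrable_Re by fastforce
  then show ?thesis using measurable_continuous_open_interval[OF assms] by (simp add: L2_def)
qed

lemma L2_cmult:
  assumes "f \<in> L2 M"
  shows "(\<lambda>x. c * f x) \<in> L2 M"
  using assms by (auto simp: L2_def norm_mult power_mult_distrib)

lemma L2_add:
  assumes "f \<in> L2 M" "g \<in> L2 M"
  shows "(\<lambda>x. f x + g x) \<in> L2 M"
proof -
  have meas: "(\<lambda>x. f x + g x) \<in> borel_measurable M"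
    using assms by (auto simp: L2_def)
  have "integrable M (\<lambda>x. 2 * (cmod (f x))\<^sup>2 + 2 * (cmod (g x))\<^sup>2)"
    using assms by (auto simp: L2_def)
  then have "integrable M (\<lambda>x. (cmod (f x + g x))\<^sup>2)"
  proof (rule Bochner_Integration.integrable_bound)
    show "(\<lambda>x. (cmod (f x + g x))\<^sup>2) \<in> borel_measurable M"
      using meas by simp
    have "(cmod (f x + g x))\<^sup>2 \<le> 2 * (cmod (f x))\<^sup>2 + 2 * (cmod (g x))\<^sup>2" for x
    proof -
      have "(cmod (f x + g x))\<^sup>2 \<le> (cmod (f x) + cmod (g x))\<^sup>2"
        by (intro power_mono norm_triangle_ineq) auto
      also have "\<dots> \<le> 2 * (cmod (f x))\<^sup>2 + 2 * (cmod (g x))\<^sup>2"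
        using sum_squares_bound[of "cmod (f x)" "cmod (g x)"] by (simp add: power2_sum)
      finally show ?thesis .
    qed
    then show "AE x in M. norm ((cmod (f x + g x))\<^sup>2) \<le> norm (2 * (cmod (f x))\<^sup>2 + 2 * (cmod (g x))\<^sup>2)"
      by (intro AE_I2) simp
  qed
  then show ?thesis using meas by (simp add: L2_def)
qed

lemma integral_const_open_interval:
  fixes c :: real
  assumes "a \<le> b"
  shows "(\<integral>x. c \<partial>lebesgue_on {a<..<b}) = c * (b - a)"
  using assms by (simp add: measure_restrict_space)

text \<open>Expand \<open>0 \<le> \<integral> (\<bar>h\<bar> - m)\<^sup>2\<close> with \<open>m\<close> the mean value of \<open>\<bar>h\<bar>\<close>.\<close>

lemma integral_norm_le_L2_norm:
  assumes "0 < \<epsilon>" and h: "h \<in> L2 (lebesgue_on {0<..<\<epsilon>})"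
  shows "(\<integral>x. cmod (h x) \<partial>lebesgue_on {0<..<\<epsilon>}) \<le> sqrt \<epsilon> * L2_norm (lebesgue_on {0<..<\<epsilon>}) h"
proof -
  let ?M = "lebesgue_on {0<..<\<epsilon>}"
  interpret finite_measure ?M by (rule finite_measure_open_interval)
  have i: "integrable ?M (\<lambda>x. cmod (h x))" "integrable ?M (\<lambda>x. (cmod (h x))\<^sup>2)"
    using integrable_of_L2[OF h] h by (auto simp: L2_def)
  define I where "I = (\<integral>x. cmod (h x) \<partial>?M)"
  define N where "N = (\<integral>x. (cmod (h x))\<^sup>2 \<partial>?M)"
  have "0 \<le> (\<integral>x. (cmod (h x) - I / \<epsilon>)\<^sup>2 \<partial>?M)" by simp
  also have "\<dots> = (\<integral>x. (cmod (h x))\<^sup>2 - 2 * (I / \<epsilon>) * cmod (h x) + (I / \<epsilon>)\<^sup>2 \<partial>?M)"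
    by (simp add: power2_diff algebra_simps)
  also have "\<dots> = (\<integral>x. (cmod (h x))\<^sup>2 - 2 * (I / \<epsilon>) * cmod (h x) \<partial>?M) + (\<integral>x. (I / \<epsilon>)\<^sup>2 \<partial>?M)"
    using i by (intro Bochner_Integration.integral_add Bochner_Integration.integrable_diff integrable_mult_right integrable_const)
  also have "\<dots> = N - 2 * (I / \<epsilon>) * I + (I / \<epsilon>)\<^sup>2 * \<epsilon>"
    using i assms(1) integral_const_open_interval[of 0 \<epsilon> "(I / \<epsilon>)\<^sup>2"]
    by (simp add: Bochner_Integration.integral_diff N_def I_def)
  also have "\<dots> = N - I\<^sup>2 / \<epsilon>"
    using assms(1) by (simp add: power2_eq_square field_simps)
  finally have "I\<^sup>2 \<le> \<epsilon> * N" using assms(1) by (simp add: field_simps)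
  then have "I \<le> sqrt (\<epsilon> * N)" by (rule real_le_rsqrt)
  then show ?thesis by (simp add: I_def N_def L2_norm_def real_sqrt_mult)
qed

lemma L2_norm_le_bound:
  assumes "0 < \<epsilon>" "0 \<le> A" "AE x in lebesgue_on {0<..<\<epsilon>}. cmod (f x) \<le> A"
  shows "L2_norm (lebesgue_on {0<..<\<epsilon>}) f \<le> A * sqrt \<epsilon>"
proof -
  interpret finite_measure "lebesgue_on {0<..<\<epsilon>}" by (rule finite_measure_open_interval)
  have "(\<integral>x. (cmod (f x))\<^sup>2 \<partial>lebesgue_on {0<..<\<epsilon>}) \<le> (\<integral>x. A\<^sup>2 \<partial>lebesgue_on {0<..<\<epsilon>})"
  proof (rule integral_mono_AE')
    show "AE x in lebesgue_on {0<..<\<epsilon>}. (cmod (f x))\<^sup>2 \<le> A\<^sup>2"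
      using assms(3) by eventually_elim (rule power_mono, auto)
  qed auto
  also have "\<dots> = A\<^sup>2 * \<epsilon>" using integral_const_open_interval[of 0 \<epsilon>] assms(1) by simp
  finally have "L2_norm (lebesgue_on {0<..<\<epsilon>}) f \<le> sqrt (A\<^sup>2 * \<epsilon>)"
    unfolding L2_norm_def by (rule real_sqrt_le_mono)
  then show ?thesis using assms(2) by (simp add: real_sqrt_mult)
qed

section \<open>Spectral analysis of the Robin Laplacian\<close>

text \<open>
  The solution of \<open>u'' = - z u\<close> with \<open>u(0) = 1\<close> that satisfies the boundary condition at \<open>0\<close>,
  its derivative, and the value at \<open>\<epsilon>\<close> of its other boundary form.
\<close>

definition robin_solution :: "real \<Rightarrow> complex \<Rightarrow> real \<Rightarrow> complex" where
  "robin_solution \<alpha> z x = ode_cos z x - of_real \<alpha> * ode_sin z x"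

definition robin_solution_deriv :: "real \<Rightarrow> complex \<Rightarrow> real \<Rightarrow> complex" where
  "robin_solution_deriv \<alpha> z x = - z * ode_sin z x - of_real \<alpha> * ode_cos z x"

definition robin_characteristic :: "real \<Rightarrow> real \<Rightarrow> complex \<Rightarrow> complex" where
  "robin_characteristic \<epsilon> \<alpha> z = - (z + (of_real \<alpha>)\<^sup>2) * ode_sin z \<epsilon>"

text \<open>Both boundary conditions prescribe u' = - \<alpha> u, so the terms \<alpha> C cancel,
  which leaves the factor z + \<alpha>^2. Its zero - \<alpha>^2 belongs to the eigenfunction exp (-
  \<alpha> x), which satisfies u' = - \<alpha> u everywhere.\<close>

lemma robin_characteristic_eq:
  "robin_solution_deriv \<alpha> z \<epsilon> + of_real \<alpha> * robin_solution \<alpha> z \<epsilon> = robin_characteristic \<epsilon> \<alpha> z"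
  by (simp add: robin_solution_def robin_solution_deriv_def robin_characteristic_def
      algebra_simps power2_eq_square)

lemma continuous_on_robin_solution [continuous_intros]: "continuous_on A (robin_solution \<alpha> z)"
  and continuous_on_robin_solution_deriv [continuous_intros]: "continuous_on A (robin_solution_deriv \<alpha> z)"
  unfolding robin_solution_def[abs_def] robin_solution_deriv_def[abs_def]
  by (intro continuous_intros)+

lemma has_vector_derivative_robin_solution:
  "(robin_solution \<alpha> z has_vector_derivative robin_solution_deriv \<alpha> z x) (at x)"
  "(robin_solution_deriv \<alpha> z has_vector_derivative - z * robin_solution \<alpha> z x) (at x)"
  unfolding robin_solution_def[abs_def] robin_solution_deriv_def[abs_def]
  by (auto intro!: derivative_eq_intros has_vector_derivative_ode_cos has_vector_derivative_ode_sin simp: algebra_simps)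

lemma volterra_at_0 [simp]: "volterra \<epsilon> K h 0 = 0"
  unfolding volterra_def by (intro integral_eq_zero_AE AE_I2) auto

text \<open>The hypothesis on c is the boundary condition at \<epsilon>. If F(z) is nonzero it can
  be solved for c, which gives surjectivity; if F(z) = 0, the choice h = 0 and c = 1 gives an
  eigenfunction.\<close>

lemma robin_laplacianI:
  assumes "0 < \<epsilon>" and h: "h \<in> L2 (lebesgue_on {0<..<\<epsilon>})"
    and c: "c * robin_characteristic \<epsilon> \<alpha> z
      = volterra \<epsilon> (ode_cos z) h \<epsilon> + of_real \<alpha> * volterra \<epsilon> (ode_sin z) h \<epsilon>"
  defines "\<psi> \<equiv> \<lambda>x. c * robin_solution \<alpha> z x - volterra \<epsilon> (ode_sin z) h x"
  shows "(\<psi>, \<lambda>x. z * \<psi> x + h x) \<in> robin_laplacian \<epsilon> \<alpha>"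
proof -
  let ?M = "lebesgue_on {0<..<\<epsilon>}" and ?S = "{0<..<\<epsilon>}"
  note hi = integrable_of_L2[OF h]
  \<comment> \<open>The derivative of \<psi>: as S(0) = 0, differentiating S * h gives C * h without
    a further term.\<close>
  define v where "v x = c * robin_solution_deriv \<alpha> z x - volterra \<epsilon> (ode_cos z) h x" for x
  have cont: "continuous_on {0..\<epsilon>} \<psi>" "continuous_on {0..\<epsilon>} v"
    unfolding \<psi>_def v_def by (intro continuous_intros continuous_on_volterra hi)+
  have int: "integrable ?M (\<lambda>x. c * robin_solution \<alpha> z x)" "integrable ?M (\<lambda>x. c * robin_solution_deriv \<alpha> z x)"
      "integrable ?M (\<lambda>x. c * (- z * robin_solution \<alpha> z x))"
      "integrable ?M (volterra \<epsilon> (ode_sin z) h)" "integrable ?M (volterra \<epsilon> (ode_cos z) h)"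
    by (intro integrable_continuous_open_interval continuous_intros continuous_on_volterra hi)+
  have w1: "has_weak_derivative ?S 1 \<psi> v"
    unfolding \<psi>_def v_def
    by (intro has_weak_derivative_diff has_weak_derivative_cmult has_weak_derivative_classical
        volterra_ode_sin_weak_derivative has_vector_derivative_robin_solution continuous_intros assms(1) int hi)
  \<comment> \<open>Here C(0) = 1 contributes the term h, so that v' = - z \<psi> - h.\<close>
  have "has_weak_derivative ?S 1 v
      (\<lambda>x. c * (- z * robin_solution \<alpha> z x) - (h x - z * volterra \<epsilon> (ode_sin z) h x))"
    unfolding v_def
    by (intro has_weak_derivative_diff has_weak_derivative_cmult has_weak_derivative_classical
        volterra_ode_cos_weak_derivative has_vector_derivative_robin_solution continuous_intros assms(1) int hi
        Bochner_Integration.integrable_diff integrable_mult_right)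
  also have "(\<lambda>x. c * (- z * robin_solution \<alpha> z x) - (h x - z * volterra \<epsilon> (ode_sin z) h x))
      = (\<lambda>x. - (z * \<psi> x + h x))"
    by (auto simp: \<psi>_def algebra_simps)
  finally have w2: "has_weak_derivative ?S 2 \<psi> (\<lambda>x. - (z * \<psi> x + h x))"
    by (rule has_weak_derivative_twice[OF assms(1) w1])
  have L2: "\<psi> \<in> L2 ?M" "v \<in> L2 ?M" "(\<lambda>x. z * \<psi> x + h x) \<in> L2 ?M"
    by (intro L2_continuous L2_add L2_cmult cont h)+
  \<comment> \<open>The second weak derivative is the negative of the image of \<psi>, so
    \<open>sobolev_H\<close> asks for this sign.\<close>
  have L2': "(\<lambda>x. - (z * \<psi> x + h x)) \<in> L2 ?M"
    using L2_cmult[OF L2(3), of "- 1"] by simp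
  have w0: "has_weak_derivative ?S 0 \<psi> \<psi>"
    by (simp add: has_weak_derivative_def)
  have "\<psi> \<in> sobolev_H 2 ?S"
    unfolding sobolev_H_def using L2 L2' w0 w1 w2
    by (auto simp: le_Suc_eq numeral_2_eq_2)
  moreover have "- v 0 - of_real \<alpha> * \<psi> 0 = 0"
    by (simp add: v_def \<psi>_def robin_solution_def robin_solution_deriv_def algebra_simps)
  moreover have "v \<epsilon> + of_real \<alpha> * \<psi> \<epsilon> = 0"
    using c unfolding robin_characteristic_eq[symmetric] by (simp add: v_def \<psi>_def algebra_simps)
  ultimately have "\<psi> \<in> robin_domain \<epsilon> \<alpha>"
    unfolding robin_domain_def using cont w1 by blast
  then show ?thesis using L2(3) w2 by (simp add: robin_laplacian_def)
qed

text \<open>The converse of \<open>robin_laplacianI\<close>. The boundary conditions are stated for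
  the continuous representatives u and v, whereas variation of constants produces y; to transfer
  them, u and v are identified with y and y' up to the endpoints.\<close>

lemma robin_laplacianD:
  fixes z :: complex
  assumes "0 < \<epsilon>" and T: "(\<psi>, \<eta>) \<in> robin_laplacian \<epsilon> \<alpha>"
  defines "h \<equiv> \<lambda>x. \<eta> x - z * \<psi> x"
  obtains c where "AE x in lebesgue_on {0<..<\<epsilon>}.
      \<psi> x = c * robin_solution \<alpha> z x - volterra \<epsilon> (ode_sin z) h x"
    and "c * robin_characteristic \<epsilon> \<alpha> z
      = volterra \<epsilon> (ode_cos z) h \<epsilon> + of_real \<alpha> * volterra \<epsilon> (ode_sin z) h \<epsilon>"
    and "h \<in> L2 (lebesgue_on {0<..<\<epsilon>})"
proof -
  let ?M = "lebesgue_on {0<..<\<epsilon>}" and ?S = "{0<..<\<epsilon>}"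
  have \<psi>: "\<psi> \<in> L2 ?M" and \<eta>: "\<eta> \<in> L2 ?M" and weak: "has_weak_derivative ?S 2 \<psi> (\<lambda>x. - \<eta> x)"
    using T by (auto simp: robin_laplacian_def robin_domain_def sobolev_H_def)
  obtain u v where u: "continuous_on {0..\<epsilon>} u" "AE x in ?M. \<psi> x = u x"
    and v: "continuous_on {0..\<epsilon>} v" "has_weak_derivative ?S 1 \<psi> v"
    and bc: "- v 0 - of_real \<alpha> * u 0 = 0" "v \<epsilon> + of_real \<alpha> * u \<epsilon> = 0"
    using T unfolding robin_laplacian_def robin_domain_def by blast
  have h: "h \<in> L2 ?M"
    using L2_add[OF \<eta> L2_cmult[OF \<psi>, of "- z"]] by (simp add: h_def)
  note hi = integrable_of_L2[OF h] and \<psi>i = integrable_of_L2[OF \<psi>]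
  have "has_weak_derivative ?S 2 \<psi> (\<lambda>x. - (z * \<psi> x + h x))"
    using weak by (simp add: h_def)
  then obtain c d where cd: "AE x in ?M. \<psi> x = c * ode_cos z x + d * ode_sin z x - volterra \<epsilon> (ode_sin z) h x"
    using weak_solution_variation_of_constants[OF assms(1) \<psi>i hi] by blast
  define y where "y x = c * ode_cos z x + d * ode_sin z x - volterra \<epsilon> (ode_sin z) h x" for x
  define y' where "y' x = c * (- z * ode_sin z x) + d * ode_cos z x - volterra \<epsilon> (ode_cos z) h x" for x
  have cont: "continuous_on {0..\<epsilon>} y" "continuous_on {0..\<epsilon>} y'"
    unfolding y_def y'_def by (intro continuous_intros continuous_on_volterra hi)+
  have "((\<lambda>x. c * ode_cos z x + d * ode_sin z x) has_vector_derivative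
      c * (- z * ode_sin z x) + d * ode_cos z x) (at x)" for x
    by (auto intro!: derivative_eq_intros has_vector_derivative_ode_cos has_vector_derivative_ode_sin)
  then have "has_weak_derivative ?S 1 y y'"
    unfolding y_def y'_def
    by (intro has_weak_derivative_diff has_weak_derivative_classical volterra_ode_sin_weak_derivative
        assms(1) hi integrable_continuous_open_interval continuous_intros continuous_on_volterra)
  then have "has_weak_derivative ?S 1 \<psi> y'"
    by (rule has_weak_derivative_cong_AE)
       (use cd in \<open>auto simp: y_def intro!: integrable_continuous_open_interval cont \<psi>i elim!: eventually_mono\<close>)
  then have "AE x in ?M. v x = y' x"
    using has_weak_derivative_unique[OF assms(1) v(2)] integrable_continuous_open_interval cont v(1) by blast
  then have vy: "v x = y' x" if "x \<in> {0..\<epsilon>}" for x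
    using continuous_on_AE_eq[OF v(1) cont(2) assms(1)] that by blast
  have "AE x in ?M. u x = y x"
    using u(2) cd by eventually_elim (simp add: y_def)
  then have uy: "u x = y x" if "x \<in> {0..\<epsilon>}" for x
    using continuous_on_AE_eq[OF u(1) cont(1) assms(1)] that by blast
  \<comment> \<open>The Volterra terms vanish at 0, so y = c and y' = d there, and h does not enter
    this condition.\<close>
  have d: "d = - (of_real \<alpha> * c)"
    using bc(1) vy[of 0] uy[of 0] assms(1) by (simp add: y_def y'_def algebra_simps) (metis minus_minus)
  have "c * robin_characteristic \<epsilon> \<alpha> z
      = volterra \<epsilon> (ode_cos z) h \<epsilon> + of_real \<alpha> * volterra \<epsilon> (ode_sin z) h \<epsilon>"
  proof -
    have "v \<epsilon> + of_real \<alpha> * u \<epsilon> = c * robin_characteristic \<epsilon> \<alpha> z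
        - (volterra \<epsilon> (ode_cos z) h \<epsilon> + of_real \<alpha> * volterra \<epsilon> (ode_sin z) h \<epsilon>)"
    proof -
      have "v \<epsilon> = y' \<epsilon>" "u \<epsilon> = y \<epsilon>" using vy uy assms(1) by auto
      then show ?thesis
        unfolding robin_characteristic_eq[symmetric]
        by (simp only: y_def y'_def d robin_solution_def robin_solution_deriv_def)
           (simp add: algebra_simps)
    qed
    then show ?thesis using bc(2) by simp
  qed
  moreover have "AE x in ?M. \<psi> x = c * robin_solution \<alpha> z x - volterra \<epsilon> (ode_sin z) h x"
    using cd by eventually_elim (simp add: d robin_solution_def algebra_simps)
  ultimately show thesis using that h by blast
qed

text \<open>The inhomogeneity g - z f is zero only almost everywhere, but Volterra operators ignore
  null sets, so the representation collapses to a multiple of \<open>robin_solution\<close>.\<close>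

lemma eigenspace_robin_laplacianD:
  assumes "0 < \<epsilon>" and "f \<in> eigenspace (lebesgue_on {0<..<\<epsilon>}) (robin_laplacian \<epsilon> \<alpha>) z"
  obtains c where "AE x in lebesgue_on {0<..<\<epsilon>}. f x = c * robin_solution \<alpha> z x"
    and "c * robin_characteristic \<epsilon> \<alpha> z = 0"
proof -
  let ?M = "lebesgue_on {0<..<\<epsilon>}"
  obtain g where g: "(f, g) \<in> robin_laplacian \<epsilon> \<alpha>" "AE x in ?M. g x = z * f x"
    using assms(2) by (auto simp: eigenspace_def)
  let ?h = "\<lambda>x. g x - z * f x"
  obtain c where c: "AE x in ?M. f x = c * robin_solution \<alpha> z x - volterra \<epsilon> (ode_sin z) ?h x"
      "c * robin_characteristic \<epsilon> \<alpha> z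
        = volterra \<epsilon> (ode_cos z) ?h \<epsilon> + of_real \<alpha> * volterra \<epsilon> (ode_sin z) ?h \<epsilon>"
      "?h \<in> L2 ?M"
    by (rule robin_laplacianD[OF assms(1) g(1), of z])
  have "AE x in ?M. ?h x = 0" using g(2) by eventually_elim simp
  then have zero: "volterra \<epsilon> (ode_sin z) ?h x = 0" "volterra \<epsilon> (ode_cos z) ?h x = 0"
    if "x \<in> {0..\<epsilon>}" for x
    using that integrable_of_L2[OF c(3)] by (auto intro!: volterra_AE_zero continuous_intros)
  have "AE x in ?M. f x = c * robin_solution \<alpha> z x"
    using c(1) AE_space by eventually_elim (simp add: zero)
  moreover have "c * robin_characteristic \<epsilon> \<alpha> z = 0"
    using c(2) zero[of \<epsilon>] assms(1) by simp
  ultimately show thesis using that by blast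
qed

lemma eigenvalue_robin_laplacian:
  assumes "0 < \<epsilon>" and "robin_characteristic \<epsilon> \<alpha> z = 0"
  shows "eigenvalue (lebesgue_on {0<..<\<epsilon>}) (robin_laplacian \<epsilon> \<alpha>) z"
    and "finite_multiplicity (lebesgue_on {0<..<\<epsilon>}) (robin_laplacian \<epsilon> \<alpha>) z"
proof -
  let ?M = "lebesgue_on {0<..<\<epsilon>}"
  have "(\<lambda>_. 0) \<in> L2 ?M" by (simp add: L2_def)
  moreover have "volterra \<epsilon> K (\<lambda>_. 0) x = 0" for K x
    unfolding volterra_def by (intro integral_eq_zero_AE AE_I2) simp
  ultimately have "(robin_solution \<alpha> z, \<lambda>x. z * robin_solution \<alpha> z x) \<in> robin_laplacian \<epsilon> \<alpha>"
    using robin_laplacianI[OF assms(1), of "\<lambda>_. 0" 1 \<alpha> z] assms(2) by simp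
  then have sol: "robin_solution \<alpha> z \<in> eigenspace ?M (robin_laplacian \<epsilon> \<alpha>) z"
    unfolding eigenspace_def by auto
  \<comment> \<open>By continuity the solution would then vanish also at 0, where its value is
    1.\<close>
  have "\<not> (AE x in ?M. robin_solution \<alpha> z x = 0)"
  proof
    assume "AE x in ?M. robin_solution \<alpha> z x = 0"
    then have "robin_solution \<alpha> z 0 = 0"
      using assms(1) by (intro continuous_on_AE_eq[of 0 \<epsilon> _ "\<lambda>_. 0"] continuous_intros) auto
    then show False by (simp add: robin_solution_def)
  qed
  with sol show "eigenvalue ?M (robin_laplacian \<epsilon> \<alpha>) z"
    unfolding eigenvalue_def by blast
  show "finite_multiplicity ?M (robin_laplacian \<epsilon> \<alpha>) z"
    unfolding finite_multiplicity_def
  proof (intro exI[of _ "{robin_solution \<alpha> z}"] conjI ballI)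
    fix f assume f: "f \<in> eigenspace ?M (robin_laplacian \<epsilon> \<alpha>) z"
    obtain c where "AE x in ?M. f x = c * robin_solution \<alpha> z x"
      by (rule eigenspace_robin_laplacianD[OF assms(1) f])
    then show "\<exists>c. AE x in ?M. f x = (\<Sum>b\<in>{robin_solution \<alpha> z}. c b * b x)"
      by (intro exI[of _ "\<lambda>_. c"]) simp
  qed (use sol in auto)
qed

text \<open>The resolvent bound passes through two other norms: |f| is bounded uniformly by a
  multiple of the integral of |h|, which is at most sqrt \<epsilon> times the L2 norm of h, and
  returning from the uniform bound to the L2 norm costs another sqrt \<epsilon>.\<close>

lemma resolvent_set_robin_laplacian:
  assumes "0 < \<epsilon>" and F: "robin_characteristic \<epsilon> \<alpha> z \<noteq> 0"
  shows "z \<in> resolvent_set (lebesgue_on {0<..<\<epsilon>}) (robin_laplacian \<epsilon> \<alpha>)"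
proof -
  let ?M = "lebesgue_on {0<..<\<epsilon>}" and ?T = "robin_laplacian \<epsilon> \<alpha>"
  let ?F = "robin_characteristic \<epsilon> \<alpha> z"
  have injective: "\<not> eigenvalue ?M ?T z"
  proof
    assume "eigenvalue ?M ?T z"
    then obtain f where f: "f \<in> eigenspace ?M ?T z" "\<not> (AE x in ?M. f x = 0)"
      unfolding eigenvalue_def by blast
    obtain c where "AE x in ?M. f x = c * robin_solution \<alpha> z x" "c * ?F = 0"
      by (rule eigenspace_robin_laplacianD[OF assms(1) f(1)])
    then show False using F f(2) by simp
  qed
  have surjective: "\<exists>(f, g) \<in> ?T. AE x in ?M. g x - z * f x = h x" if "h \<in> L2 ?M" for h
  proof -
    define c where "c = (volterra \<epsilon> (ode_cos z) h \<epsilon> + of_real \<alpha> * volterra \<epsilon> (ode_sin z) h \<epsilon>) / ?F"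
    show ?thesis
      by (rule bexI[OF _ robin_laplacianI[OF assms(1) that, of c]]) (use F in \<open>auto simp: c_def\<close>)
  qed
  obtain B1 where B1: "0 < B1" "\<And>h x. integrable ?M h \<Longrightarrow> x \<in> {0..\<epsilon>} \<Longrightarrow>
      cmod (volterra \<epsilon> (ode_sin z) h x) \<le> B1 * (\<integral>t. cmod (h t) \<partial>?M)"
    by (rule volterra_bound[OF continuous_on_ode_sin[of UNIV z], of \<epsilon>]) (rule that; blast)
  obtain B2 where B2: "0 < B2" "\<And>h x. integrable ?M h \<Longrightarrow> x \<in> {0..\<epsilon>} \<Longrightarrow>
      cmod (volterra \<epsilon> (ode_cos z) h x) \<le> B2 * (\<integral>t. cmod (h t) \<partial>?M)"
    by (rule volterra_bound[OF continuous_on_ode_cos[of UNIV z], of \<epsilon>]) (rule that; blast)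
  have "bounded (robin_solution \<alpha> z ` {0..\<epsilon>})"
    by (intro compact_imp_bounded compact_continuous_image continuous_intros) auto
  then obtain R where R: "0 < R" "\<And>x. x \<in> {0..\<epsilon>} \<Longrightarrow> cmod (robin_solution \<alpha> z x) \<le> R"
    unfolding bounded_pos by (metis imageI)
  \<comment> \<open>The boundary equation at \<epsilon>, divided by |F(z)|, bounds |c| by
    \<open>D\<close> times the integral of |h|.\<close>
  define D where "D = (B2 + \<bar>\<alpha>\<bar> * B1) / cmod ?F"
  have D: "0 \<le> D" using B1(1) B2(1) by (simp add: D_def)
  have bounded: "L2_norm ?M f \<le> ((D * R + B1) * \<epsilon>) * L2_norm ?M (\<lambda>x. g x - z * f x)"
    if T: "(f, g) \<in> ?T" for f g
  proof -
    let ?h = "\<lambda>x. g x - z * f x"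
    obtain c where c: "AE x in ?M. f x = c * robin_solution \<alpha> z x - volterra \<epsilon> (ode_sin z) ?h x"
        "c * ?F = volterra \<epsilon> (ode_cos z) ?h \<epsilon> + of_real \<alpha> * volterra \<epsilon> (ode_sin z) ?h \<epsilon>"
        "?h \<in> L2 ?M"
      by (rule robin_laplacianD[OF assms(1) T, of z])
    define I where "I = (\<integral>t. cmod (?h t) \<partial>?M)"
    have I: "0 \<le> I" by (simp add: I_def)
    note hi = integrable_of_L2[OF c(3)]
    have "cmod c * cmod ?F \<le> B2 * I + \<bar>\<alpha>\<bar> * (B1 * I)"
      unfolding norm_mult[symmetric] c(2) I_def using assms(1)
      by (intro order_trans[OF norm_triangle_ineq] add_mono)
         (auto simp: norm_mult intro!: mult_left_mono B1(2) B2(2) hi)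
    then have "cmod c \<le> D * I"
      using F by (simp add: D_def field_simps)
    have "AE x in ?M. cmod (f x) \<le> (D * R + B1) * I"
      using c(1) AE_space
    proof eventually_elim
      case (elim x)
      then have x: "x \<in> {0..\<epsilon>}" by simp
      have "cmod (f x) \<le> cmod c * cmod (robin_solution \<alpha> z x) + cmod (volterra \<epsilon> (ode_sin z) ?h x)"
        unfolding elim(1) norm_mult[symmetric] by (rule norm_triangle_ineq4)
      also have "\<dots> \<le> (D * I) * R + B1 * I"
        using \<open>cmod c \<le> D * I\<close> R(2)[OF x] B1(2)[OF hi x] D I
        by (intro add_mono mult_mono) (auto simp: I_def)
      finally show ?case by (simp add: algebra_simps)
    qed
    then have "L2_norm ?M f \<le> (D * R + B1) * I * sqrt \<epsilon>"
      using D R(1) B1(1) I by (intro L2_norm_le_bound assms(1)) auto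
    also have "\<dots> \<le> (D * R + B1) * (sqrt \<epsilon> * L2_norm ?M ?h) * sqrt \<epsilon>"
      using D R(1) B1(1) assms(1) integral_norm_le_L2_norm[OF assms(1) c(3)]
      by (intro mult_right_mono mult_left_mono) (auto simp: I_def)
    also have "\<dots> = ((D * R + B1) * (sqrt \<epsilon> * sqrt \<epsilon>)) * L2_norm ?M ?h"
      by (simp only: ac_simps)
    also have "\<dots> = ((D * R + B1) * \<epsilon>) * L2_norm ?M ?h"
      using assms(1) by simp
    finally show ?thesis .
  qed
  show ?thesis
    unfolding resolvent_set_def using injective surjective bounded by blast
qed

section \<open>Location and local finiteness of the zeros of F\<close>

lemma robin_characteristic_zeros:
  assumes "0 < \<epsilon>" and "robin_characteristic \<epsilon> \<alpha> z = 0"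
  shows "z = - (of_real \<alpha>)\<^sup>2 \<or> (\<exists>n::int. z = of_real ((of_int n * pi / \<epsilon>)\<^sup>2))"
proof (cases "z + (of_real \<alpha>)\<^sup>2 = 0")
  case True
  then show ?thesis by (simp add: eq_neg_iff_add_eq_0)
next
  case False
  then have "ode_sin z \<epsilon> = 0" using assms(2) unfolding robin_characteristic_def by (metis mult_eq_0_iff neg_equal_0_iff_equal)
  \<comment> \<open>At z = 0 the value of \<open>ode_sin\<close> is \<epsilon>, not 0, so only the
    branch with the sine remains.\<close>
  then have "z \<noteq> 0" "sin (csqrt z * of_real \<epsilon>) = 0"
    using assms(1) by (auto simp: ode_sin_def split: if_splits)
  then obtain n :: int where "csqrt z * of_real \<epsilon> = of_real (of_int n * pi)"
    by (auto simp: sin_eq_0)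
  then have "csqrt z = of_real (of_int n * pi / \<epsilon>)"
    using assms(1) by (simp add: field_simps)
  then have "z = of_real ((of_int n * pi / \<epsilon>)\<^sup>2)"
    by (metis power2_csqrt of_real_power)
  then show ?thesis by blast
qed

lemma finite_robin_characteristic_zeros_cball:
  assumes "0 < \<epsilon>"
  shows "finite ({z. robin_characteristic \<epsilon> \<alpha> z = 0} \<inter> cball 0 r)"
proof -
  let ?f = "\<lambda>n::int. complex_of_real ((of_int n * pi / \<epsilon>)\<^sup>2)"
  let ?N = "\<lceil>\<epsilon> * (1 + \<bar>r\<bar>)\<rceil>"
  have "\<bar>n\<bar> \<le> ?N" if "?f n \<in> cball 0 r" for n
  proof -
    have "(\<bar>of_int n\<bar> * pi / \<epsilon>)\<^sup>2 \<le> r"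
      using that by (simp add: norm_power norm_mult norm_divide power_mult_distrib power_divide)
    \<comment> \<open>Comparison with a square for every real r avoids the root of r and a
      distinction by its sign.\<close>
    also have "\<dots> \<le> (1 + \<bar>r\<bar>)\<^sup>2"
      using abs_ge_self[of r] zero_le_power2[of "\<bar>r\<bar>"]
      unfolding power2_sum power_one mult_1_right by linarith
    finally have "\<bar>of_int n\<bar> * pi / \<epsilon> \<le> 1 + \<bar>r\<bar>"
      by (rule power2_le_imp_le) simp
    then have "\<bar>of_int n\<bar> * pi \<le> \<epsilon> * (1 + \<bar>r\<bar>)"
      using assms by (simp add: field_simps)
    moreover have "\<bar>of_int n\<bar> * 1 \<le> \<bar>of_int n\<bar> * pi"
      using pi_ge_two by (intro mult_left_mono) auto
    ultimately have "\<bar>real_of_int n\<bar> \<le> \<epsilon> * (1 + \<bar>r\<bar>)" by linarith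
    then show ?thesis by linarith
  qed
  then have "{z. robin_characteristic \<epsilon> \<alpha> z = 0} \<inter> cball 0 r \<subseteq> insert (- (of_real \<alpha>)\<^sup>2) (?f ` {- ?N..?N})"
    using robin_characteristic_zeros[OF assms] by (fastforce simp: abs_le_iff)
  then show ?thesis by (rule finite_subset) simp
qed

theorem theorem5:
  fixes \<epsilon> \<alpha> :: real
  assumes "\<epsilon> > 0" and "\<alpha> \<noteq> 0"
  shows "essential_spectrum (lebesgue_on {0<..<\<epsilon>}) (robin_laplacian \<epsilon> \<alpha>) = {}"
proof -
  let ?M = "lebesgue_on {0<..<\<epsilon>}" and ?T = "robin_laplacian \<epsilon> \<alpha>"
  let ?Z = "{z. robin_characteristic \<epsilon> \<alpha> z = 0}"
  have spectrum: "spectrum ?M ?T \<subseteq> ?Z"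
    using resolvent_set_robin_laplacian[OF assms(1)] by (auto simp: spectrum_def)
  have "z \<in> discrete_spectrum ?M ?T" if z: "z \<in> spectrum ?M ?T" for z
  proof -
    have "\<not> z islimpt spectrum ?M ?T"
    proof
      assume "z islimpt spectrum ?M ?T"
      \<comment> \<open>Being a limit point is local and monotone in the set, so only the zeros near
        z matter, and these are finitely many.\<close>
      then have "z islimpt (?Z \<inter> ball z 1)"
        by (intro islimpt_Int_eventually islimpt_subset[OF _ spectrum] eventually_at_in_open') auto
      moreover have "?Z \<inter> ball z 1 \<subseteq> ?Z \<inter> cball 0 (norm z + 1)"
      proof
        fix w assume "w \<in> ?Z \<inter> ball z 1"
        then show "w \<in> ?Z \<inter> cball 0 (norm z + 1)"
          using norm_triangle_sub[of w z] by (auto simp: dist_norm norm_minus_commute)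
      qed
      then have "finite (?Z \<inter> ball z 1)"
        using finite_robin_characteristic_zeros_cball[OF assms(1)] by (rule finite_subset)
      ultimately show False by (simp add: islimpt_finite)
    qed
    then have "z isolated_in spectrum ?M ?T"
      using z by (simp add: isolated_in_islimpt_iff)
    moreover have "robin_characteristic \<epsilon> \<alpha> z = 0" using z spectrum by blast
    ultimately show ?thesis
      using eigenvalue_robin_laplacian[OF assms(1)] by (simp add: discrete_spectrum_def)
  qed
  then show ?thesis by (auto simp: essential_spectrum_def)
qed

end
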